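(* Let $\Bbbk$ be a field in which every element has a square root, and let $\Gamma=(V,E)$ be a connected graph. Then there is an isomorphism of sets (a bijection) $$\Sigma/_{\sim}\;\cong\;\mathrm{SZC}/_{\equiv}$$ and an isomorphism of groups $$\mathrm{SZC}/_{\equiv}\;\cong\; H^1(\Gamma,\Bbbk^* ).$$
   Context: Graphs $\Gamma=(V,E)$ are finite, with no loops or multiple edges ($E$ is a set of two-element subsets of $V$). The double graph $D\Gamma$ is the quiver with vertex set $V$ and, for each $\{a,b\}\in E$, two directed edges $(a\,|\,b)$ (from $a$ to $b$) and $(b\,|\,a)$ (from $b$ to $a$). Let $E'$ be its set of directed edges. Paths in $D\Gamma$ are written $(a_1\,|\,\dots\,|\,a_n)$ (with $\{a_i,a_{i+1}\}\in E$), of length $n-1$, with $(a)$ the trivial path at $a$. The path algebra $\Bbbk D\Gamma$ has the paths as basis and multiplication by concatenation (zero if the end of the first is not the start of the second), graded by path length. A collection of skew-zigzag coefficients is a family $v=(v^a_{b,c}\in\Bbbk : \{a,b\},\{a,c\}\in E)$ with $v^a_{b,b}=1$, $v^a_{b,c}v^a_{c,b}=1$, and $v^a_{b,c}v^a_{c,d}v^a_{d,b}=1$ whenever the vertices $b,c,d$ involved are all adjacent to $a$. $\mathrm{SZC}$ is the set of all such collections, a group under entrywise multiplication $(u\cdot v)^a_{b,c}=u^a_{b,c}v^a_{b,c}$. The skew-zigzag algebra $A_v(\Gamma)$ is defined as follows. If $|V|\ge 3$: $A_v(\Gamma)=\Bbbk D\Gamma/I_v$, where $I_v$ is the two-sided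 ideal generated by all paths $(a_1\,|\,a_2\,|\,a_3)$ with $a_1\ne a_3$ and all $(a_1\,|\,a_2\,|\,a_1)-v^{a_1}_{a_2,a_3}(a_1\,|\,a_3\,|\,a_1)$ with $a_1$ adjacent to $a_2$ and $a_3$. If $|V|=2$: $A_v(\Gamma)$ is the quotient of $\Bbbk D\Gamma$ by the two-sided ideal generated by all paths of length greater than two. If $|V|=1$: $A_v(\Gamma)=\Bbbk[X]/(X^2)$ with $X$ in degree $2$ (and $[a]=1$ for the unique vertex $a$). $[P]$ denotes the class of a path $P$. $A_v(\Gamma)$ is graded by path length. On $\mathrm{SZC}$: $v\equiv u$ iff there is an isomorphism of graded $\Bbbk$-algebras $\phi:A_v(\Gamma)\to A_u(\Gamma)$ with $\phi([a])=[a]$ for all $a\in V$. $\mathrm{SZC}/_\equiv$ carries the group structure induced from $\mathrm{SZC}$. Let $\Sigma=\{A_v(\Gamma): v\in\mathrm{SZC}\}$; on $\Sigma$, $A_v(\Gamma)\sim A_u(\Gamma)$ iff there is an isomorphism of graded $\Bbbk$-algebras $\phi:A_v(\Gamma)\to A_u(\Gamma)$ with $\phi([a])=[a]$ for all $a\in V$. The space of cycles $\mathcal C$ of $\Gamma$ is the kernel of the homomorphism $\delta$ from the quotient of the free abelian group $\mathbb Z E'$ by the subgroup generated by $\{(a\,|\,b)+(b\,|\,a):\{a,b\}\in E\}$ to $\mathbb Z V$, determined by $(a\,|\,b)\mapsto a-b$. The graph cohomology is $H^1(\Gamma,\Bbbk^* )=\mathrm{Hom}_{\mathrm{group}}(\mathcal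 C,\Bbbk^* )$, a group under pointwise multiplication. *)

theory Defs
  imports
    "HOL-Algebra.QuotRing"
    "HOL-Algebra.Module"
    "HOL-Algebra.Generated_Groups"
    "HOL-Algebra.Free_Abelian_Groups"
begin

section \<open>Graphs and paths in the double graph\<close>

definition simple_graph :: "'v set \<Rightarrow> 'v set set \<Rightarrow> bool" where
  "simple_graph V E \<longleftrightarrow> finite V \<and> (\<forall>e\<in>E. e \<subseteq> V \<and> card e = 2)"

text \<open>
  A path \<open>(a\<^sub>1 | \<dots> | a\<^sub>n)\<close> of the double graph is the nonempty list of its vertices;
  its length is \<open>n - 1\<close>.
\<close>
definition graph_path :: "'v set \<Rightarrow> 'v set set \<Rightarrow> 'v list \<Rightarrow> bool" where
  "graph_path V E p \<longleftrightarrow> p \<noteq> [] \<and> set p \<subseteq> V \<and> successively (\<lambda>a b. {a, b} \<in> E) p"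

text \<open>Connected graphs are nonempty.\<close>
definition connected_graph :: "'v set \<Rightarrow> 'v set set \<Rightarrow> bool" where
  "connected_graph V E \<longleftrightarrow> V \<noteq> {} \<and>
     (\<forall>a\<in>V. \<forall>b\<in>V. \<exists>p. graph_path V E p \<and> hd p = a \<and> last p = b)"

section \<open>Graded algebras with marked vertex classes\<close>

text \<open>
  A graded \<open>k\<close>-algebra together with the elements \<open>[a]\<close>, for vertices \<open>a\<close>.  Algebra isomorphisms
  are required to respect the marked elements only where this is stated explicitly.
\<close>
record ('k, 'a, 'v) graded_algebra = "('k, 'a) module" +
  component :: "nat \<Rightarrow> 'a set"
  vertex_class :: "'v \<Rightarrow> 'a"

definition graded_algebra_iso ::
  "('k, 'a, 'v) graded_algebra \<Rightarrow> ('k, 'b, 'v) graded_algebra \<Rightarrow> ('a \<Rightarrow> 'b) set" where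
  "graded_algebra_iso A B =
     {\<phi> \<in> ring_iso A B.
        (\<forall>c. \<forall>x\<in>carrier A. \<phi> (c \<odot>\<^bsub>A\<^esub> x) = c \<odot>\<^bsub>B\<^esub> \<phi> x) \<and>
        (\<forall>n. \<phi> ` component A n = component B n)}"

text \<open>Like the product in \<open>A Quot I\<close>, scalar multiples of cosets are formed from all representatives.\<close>
definition quotient_algebra ::
  "('k, 'a, 'v) graded_algebra \<Rightarrow> 'a set \<Rightarrow> ('k, 'a set, 'v) graded_algebra" where
  "quotient_algebra A I =
     \<lparr> carrier = carrier (A Quot I), mult = monoid.mult (A Quot I), one = monoid.one (A Quot I),
       ring.zero = ring.zero (A Quot I), add = ring.add (A Quot I),
       smult = (\<lambda>c X. \<Union>x\<in>X. I +>\<^bsub>A\<^esub> (c \<odot>\<^bsub>A\<^esub> x)),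
       component = (\<lambda>n. (\<lambda>x. I +>\<^bsub>A\<^esub> x) ` component A n),
       vertex_class = (\<lambda>a. I +>\<^bsub>A\<^esub> vertex_class A a) \<rparr>"

section \<open>Path algebras and the polynomial algebra\<close>

text \<open>
  The skew-zigzag algebra is a quotient of the path algebra of the double graph, except for the
  one-vertex graph, where it is a quotient of \<open>k[X]\<close>.  In order to have all skew-zigzag
  algebras in one type, both are built on finitely supported functions over a common type of
  basis elements: \<open>Path p\<close> for a path \<open>p\<close>, and \<open>Power n\<close> for the monomial \<open>X\<^sup>n\<close> of \<open>k[X]\<close>.
  As \<open>X\<close> has degree 2, the degree of \<open>Power n\<close> is \<open>2 * n\<close>.
\<close>
datatype 'v basis = Path "'v list" | Power nat

fun basis_degree :: "'v basis \<Rightarrow> nat" where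
  "basis_degree (Path p) = length p - 1"
| "basis_degree (Power n) = 2 * n"

text \<open>The product of two basis elements; \<open>None\<close> stands for the product being zero.\<close>
fun basis_mult :: "'v basis \<Rightarrow> 'v basis \<Rightarrow> 'v basis option" where
  "basis_mult (Path p) (Path q) = (if last p = hd q then Some (Path (p @ tl q)) else None)"
| "basis_mult (Power m) (Power n) = Some (Power (m + n))"
| "basis_mult _ _ = None"

type_synonym ('v, 'k) combination = "'v basis \<Rightarrow>\<^sub>0 'k"

definition combination_mult ::
  "('v, 'k::field) combination \<Rightarrow> ('v, 'k) combination \<Rightarrow> ('v, 'k) combination" where
  "combination_mult f g =
     (\<Sum>x\<in>Poly_Mapping.keys f. \<Sum>y\<in>Poly_Mapping.keys g.
        case basis_mult x y of
          None \<Rightarrow> 0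
        | Some z \<Rightarrow> Poly_Mapping.single z (Poly_Mapping.lookup f x * Poly_Mapping.lookup g y))"

abbreviation path_elem :: "'v list \<Rightarrow> ('v, 'k::field) combination" where
  "path_elem p \<equiv> Poly_Mapping.single (Path p) 1"

abbreviation power_elem :: "nat \<Rightarrow> ('v, 'k::field) combination" where
  "power_elem n \<equiv> Poly_Mapping.single (Power n) 1"

definition basis_algebra ::
  "'v basis set \<Rightarrow> ('v, 'k::field) combination \<Rightarrow> ('v \<Rightarrow> ('v, 'k) combination)
    \<Rightarrow> ('k, ('v, 'k) combination, 'v) graded_algebra" where
  "basis_algebra B e w =
     \<lparr> carrier = {f. Poly_Mapping.keys f \<subseteq> B}, mult = combination_mult, one = e,
       ring.zero = 0, add = (+),
       smult = (\<lambda>c f. Poly_Mapping.map (\<lambda>x. c * x) f),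
       component = (\<lambda>n. {f. Poly_Mapping.keys f \<subseteq> {x \<in> B. basis_degree x = n}}),
       vertex_class = w \<rparr>"

definition path_algebra ::
  "'v set \<Rightarrow> 'v set set \<Rightarrow> ('k::field, ('v, 'k) combination, 'v) graded_algebra" where
  "path_algebra V E =
     basis_algebra (Path ` {p. graph_path V E p}) (\<Sum>a\<in>V. path_elem [a]) (\<lambda>a. path_elem [a])"

text \<open>The algebra \<open>k[X]\<close>, with \<open>1\<close> as the marked element \<open>[a]\<close>.\<close>
definition polynomial_algebra :: "('k::field, ('v, 'k) combination, 'v) graded_algebra" where
  "polynomial_algebra = basis_algebra (range Power) (power_elem 0) (\<lambda>a. power_elem 0)"

section \<open>Skew-zigzag coefficients\<close>

text \<open>
  \<open>v a b c\<close> is the coefficient \<open>v\<^sup>a\<^bsub>b,c\<^esub>\<close>.  It is meaningful only if \<open>b\<close> and \<open>c\<close> are adjacent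
  to \<open>a\<close>; the last condition fixes the value 1 elsewhere, so that collections correspond to
  families indexed by the meaningful triples.
\<close>
definition SZC :: "'v set set \<Rightarrow> ('v \<Rightarrow> 'v \<Rightarrow> 'v \<Rightarrow> 'k::field) set" where
  "SZC E =
     {v. (\<forall>a b. {a, b} \<in> E \<longrightarrow> v a b b = 1) \<and>
         (\<forall>a b c. {a, b} \<in> E \<and> {a, c} \<in> E \<longrightarrow> v a b c * v a c b = 1) \<and>
         (\<forall>a b c d. {a, b} \<in> E \<and> {a, c} \<in> E \<and> {a, d} \<in> E \<longrightarrow>
            v a b c * v a c d * v a d b = 1) \<and>
         (\<forall>a b c. \<not> ({a, b} \<in> E \<and> {a, c} \<in> E) \<longrightarrow> v a b c = 1)}"

definition SZC_group :: "'v set set \<Rightarrow> ('v \<Rightarrow> 'v \<Rightarrow> 'v \<Rightarrow> 'k::field) monoid" where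
  "SZC_group E =
     \<lparr> carrier = SZC E, mult = (\<lambda>u v a b c. u a b c * v a b c), one = (\<lambda>a b c. 1) \<rparr>"

section \<open>Skew-zigzag algebras\<close>

definition skew_zigzag_relations ::
  "'v set set \<Rightarrow> ('v \<Rightarrow> 'v \<Rightarrow> 'v \<Rightarrow> 'k::field) \<Rightarrow> ('v, 'k) combination set" where
  "skew_zigzag_relations E v =
     {path_elem [a, b, c] | a b c. {a, b} \<in> E \<and> {b, c} \<in> E \<and> a \<noteq> c} \<union>
     {path_elem [a, b, a] - Poly_Mapping.single (Path [a, c, a]) (v a b c) | a b c.
        {a, b} \<in> E \<and> {a, c} \<in> E}"

definition skew_zigzag_algebra ::
  "'v set \<Rightarrow> 'v set set \<Rightarrow> ('v \<Rightarrow> 'v \<Rightarrow> 'v \<Rightarrow> 'k::field)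
    \<Rightarrow> ('k, ('v, 'k) combination set, 'v) graded_algebra" where
  "skew_zigzag_algebra V E v =
     (if card V = 1 then
        quotient_algebra polynomial_algebra (Idl\<^bsub>polynomial_algebra\<^esub> {power_elem 2})
      else if card V = 2 then
        quotient_algebra (path_algebra V E)
          (Idl\<^bsub>path_algebra V E\<^esub> {path_elem p | p. graph_path V E p \<and> length p - 1 > 2})
      else
        quotient_algebra (path_algebra V E)
          (Idl\<^bsub>path_algebra V E\<^esub> (skew_zigzag_relations E v)))"

definition vertex_preserving_isomorphic ::
  "'v set \<Rightarrow> ('k, 'a, 'v) graded_algebra \<Rightarrow> ('k, 'a, 'v) graded_algebra \<Rightarrow> bool" where
  "vertex_preserving_isomorphic V A B \<longleftrightarrow>
     (\<exists>\<phi>\<in>graded_algebra_iso A B. \<forall>a\<in>V. \<phi> (vertex_class A a) = vertex_class B a)"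

definition skew_zigzag_algebras ::
  "'v set \<Rightarrow> 'v set set \<Rightarrow> ('k::field, ('v, 'k) combination set, 'v) graded_algebra set" where
  "skew_zigzag_algebras V E = skew_zigzag_algebra V E ` SZC E"

definition algebra_rel ::
  "'v set \<Rightarrow> 'v set set \<Rightarrow> ('k::field, ('v, 'k) combination set, 'v) graded_algebra rel" where
  "algebra_rel V E =
     {(A, B). A \<in> skew_zigzag_algebras V E \<and> B \<in> skew_zigzag_algebras V E \<and>
        vertex_preserving_isomorphic V A B}"

definition SZC_rel :: "'v set \<Rightarrow> 'v set set \<Rightarrow> ('v \<Rightarrow> 'v \<Rightarrow> 'v \<Rightarrow> 'k::field) rel" where
  "SZC_rel V E =
     {(v, u). v \<in> SZC E \<and> u \<in> SZC E \<and>
        vertex_preserving_isomorphic V (skew_zigzag_algebra V E v) (skew_zigzag_algebra V E u)}"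

text \<open>
  As for quotient groups in \<open>HOL-Algebra\<close>, the product of two classes is their elementwise product
  \<^const>\<open>set_mult\<close>.
\<close>
definition SZC_quotient ::
  "'v set \<Rightarrow> 'v set set \<Rightarrow> ('v \<Rightarrow> 'v \<Rightarrow> 'v \<Rightarrow> 'k::field) set monoid" where
  "SZC_quotient V E =
     \<lparr> carrier = SZC E // SZC_rel V E, mult = set_mult (SZC_group E),
       one = SZC_rel V E `` {\<one>\<^bsub>SZC_group E\<^esub>} \<rparr>"

section \<open>Graph cohomology\<close>

definition directed_edges :: "'v set set \<Rightarrow> ('v \<times> 'v) set" where
  "directed_edges E = {(a, b). {a, b} \<in> E}"

definition chain_group :: "'v set set \<Rightarrow> ('v \<times> 'v \<Rightarrow>\<^sub>0 int) set monoid" where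
  "chain_group E =
     free_Abelian_group (directed_edges E) Mod
       generate (free_Abelian_group (directed_edges E))
         {frag_of (a, b) + frag_of (b, a) | a b. {a, b} \<in> E}"

text \<open>
  \<open>(a | b) \<mapsto> a - b\<close> extends linearly to \<open>\<int>E'\<close>.  The extension is constant on the cosets that
  make up \<open>chain_group E\<close>; \<open>boundary\<close> takes this constant value.
\<close>
definition boundary :: "('v \<times> 'v \<Rightarrow>\<^sub>0 int) set \<Rightarrow> ('v \<Rightarrow>\<^sub>0 int)" where
  "boundary X = the_elem (frag_extend (\<lambda>(a, b). frag_of a - frag_of b) ` X)"

definition cycle_space :: "'v set \<Rightarrow> 'v set set \<Rightarrow> ('v \<times> 'v \<Rightarrow>\<^sub>0 int) set monoid" where
  "cycle_space V E =
     (chain_group E)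
       \<lparr> carrier := kernel (chain_group E) (free_Abelian_group V) boundary \<rparr>"

definition unit_group :: "'k::field monoid" where
  "unit_group = \<lparr> carrier = UNIV - {0}, mult = (*), one = 1 \<rparr>"

text \<open>Homomorphisms are taken to be \<^const>\<open>undefined\<close> outside of the cycle space.\<close>
definition graph_cohomology ::
  "'v set \<Rightarrow> 'v set set \<Rightarrow> (('v \<times> 'v \<Rightarrow>\<^sub>0 int) set \<Rightarrow> 'k::field) monoid" where
  "graph_cohomology V E =
     \<lparr> carrier = hom (cycle_space V E) unit_group \<inter> extensional (carrier (cycle_space V E)),
       mult = (\<lambda>f g. \<lambda>x\<in>carrier (cycle_space V E). f x * g x),
       one = (\<lambda>x\<in>carrier (cycle_space V E). 1) \<rparr>"

end

theory Submission
  imports Defs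
begin

text \<open>
  The relation \<open>\<equiv>\<close> on coefficients is governed by rescalings.  The part of \<open>A\<^sub>v\<close> of degree 1 between
  \<open>[a]\<close> and \<open>[b]\<close> is spanned by the edge \<open>(a | b)\<close>.  Hence an isomorphism that fixes the vertex
  idempotents sends \<open>(a | b)\<close> to a multiple \<open>t a b\<close> of itself and scales the loop \<open>(a | b | a)\<close> by
  \<open>m a b = t a b * t b a\<close>, which is symmetric in \<open>a\<close> and \<open>b\<close>.  Applied to the relation
  \<open>(a | b | a) = v a b c (a | c | a)\<close>, this gives \<open>u a b c * m a b = v a b c * m a c\<close>, provided
  that the loops at \<open>a\<close> do not vanish in \<open>A\<^sub>u\<close>; this holds because of the cocycle condition on \<open>u\<close>.
  Conversely, given such a symmetric \<open>m\<close>, square roots of \<open>m\<close> serve as \<open>t\<close>, and rescaling the edges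
  by \<open>t\<close> is an automorphism of the path algebra that carries one ideal to the other.
  \<open>SZC_rel_iff\<close> states the resulting criterion; for at most two vertices, where \<open>A\<^sub>v\<close> has other
  relations, it holds because all coefficients are 1.
  
  For the cohomology, the cocycle condition at \<open>a\<close> means that \<open>v a b c = l a b / l a c\<close>, where
  \<open>l a\<close> is unique up to a factor \<open>f a\<close>.  Two collections are equivalent iff their \<open>l\<close> differ by
  such factors and by a symmetric function.  The ratio \<open>l a b / l b a\<close> forgets exactly the symmetric
  functions, it is inverted when an edge is reversed, and a factor \<open>f\<close> changes it by \<open>f a / f b\<close>.
  So it is a character of the chain group whose restriction to the cycles depends only on the
  class of \<open>v\<close>; this restriction is \<open>cohomology_map\<close>.
  
  If the restriction is trivial, then in a connected graph the value of the character on a path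
  from a base vertex to \<open>a\<close> does not depend on the path, and yields the function \<open>f\<close> that makes \<open>v\<close>
  trivial (\<open>cohomology_map_eq_one_iff\<close>).  On the other hand, the same paths close up every edge
  \<open>(a | b)\<close> to a cycle, which projects the chains onto the cycles.  So every character of the cycles
  extends to the chains, and it comes from a collection of coefficients because an orientation of the
  edges turns an antisymmetric function into a ratio \<open>l a b / l b a\<close> (\<open>cohomology_map_surj\<close>).  The
  first isomorphism theorem then gives the isomorphism of groups.  The bijection with classes of
  algebras is formal: \<open>\<equiv>\<close> is the pullback of \<open>\<sim>\<close> along the surjection \<open>v \<mapsto> A\<^sub>v\<close>.
\<close>

section \<open>Products of paths\<close>

abbreviation coef :: "('v, 'k::zero) combination \<Rightarrow> 'v list \<Rightarrow> 'k" where
  "coef f p \<equiv> Poly_Mapping.lookup f (Path p)"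

text \<open>
  A path \<open>r\<close> is a product of two paths in as many ways as it has vertices: it is cut at one of its
  vertices, which then belongs to both factors.  So the product is a convolution along these cuts.
  The empty list has to be excluded because it is not a path, but \<^const>\<open>last\<close> and \<^const>\<open>hd\<close> assign some
  vertex to it, so that it could occur as a factor as well.
\<close>
lemma coef_combination_mult:
  fixes f g :: "('v, 'k::field) combination"
  assumes f: "coef f [] = 0" and g: "coef g [] = 0"
  shows "coef (combination_mult f g) r = (\<Sum>i<length r. coef f (take (Suc i) r) * coef g (drop i r))"
proof -
  let ?K = "Poly_Mapping.keys f \<times> Poly_Mapping.keys g"
  let ?h = "\<lambda>(x, y). Poly_Mapping.lookup f x * Poly_Mapping.lookup g y"
  let ?c = "\<lambda>i. (Path (take (Suc i) r), Path (drop i r))"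
  have cut: "(basis_mult x y = Some (Path r)) = ((x, y) \<in> ?c ` {..<length r})" if "(x, y) \<in> ?K" for x y
  proof
    assume "basis_mult x y = Some (Path r)"
    then obtain p q where xy: "x = Path p" "y = Path q" and pq: "last p = hd q" "r = p @ tl q"
      by (cases x; cases y) (auto split: if_splits)
    have "p \<noteq> []" "q \<noteq> []"
      using that f g xy by (auto simp: in_keys_iff)
    then have "take (Suc (length p - 1)) r = p" "drop (length p - 1) r = q" "length p - 1 < length r"
      using pq by (cases p rule: rev_cases; cases q; simp)+
    then show "(x, y) \<in> ?c ` {..<length r}"
      using xy by force
  next
    assume "(x, y) \<in> ?c ` {..<length r}"
    then obtain i where i: "i < length r" "x = Path (take (Suc i) r)" "y = Path (drop i r)"
      by auto
    moreover have "last (take (Suc i) r) = hd (drop i r)" "take (Suc i) r @ tl (drop i r) = r"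
      using i(1) by (simp_all add: take_Suc_conv_app_nth hd_drop_conv_nth flip: Cons_nth_drop_Suc)
        (metis append_take_drop_id Cons_nth_drop_Suc)
    ultimately show "basis_mult x y = Some (Path r)"
      by simp
  qed
  have "coef (combination_mult f g) r =
      (\<Sum>x\<in>Poly_Mapping.keys f. \<Sum>y\<in>Poly_Mapping.keys g.
        if basis_mult x y = Some (Path r) then ?h (x, y) else 0)"
    unfolding combination_mult_def lookup_sum
    by (intro sum.cong refl) (auto simp: lookup_single when_def split: option.split)
  also have "\<dots> = (\<Sum>z\<in>?K. if z \<in> ?c ` {..<length r} then ?h z else 0)"
    unfolding sum.cartesian_product
  proof (intro sum.cong refl)
    fix z assume "z \<in> ?K"
    then show "(case z of (x, y) \<Rightarrow> if basis_mult x y = Some (Path r) then ?h (x, y) else 0) =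
        (if z \<in> ?c ` {..<length r} then ?h z else 0)"
      using cut[of "fst z" "snd z"] by (cases z) (simp only: fst_conv snd_conv prod.case)
  qed
  also have "\<dots> = sum ?h (?K \<inter> ?c ` {..<length r})"
    by (simp add: sum.inter_restrict)
  also have "\<dots> = sum ?h (?c ` {..<length r})"
    by (rule sum.mono_neutral_left) (auto simp: in_keys_iff)
  also have "\<dots> = (\<Sum>i<length r. ?h (?c i))"
  proof (subst sum.reindex)
    show "inj_on ?c {..<length r}"
    proof (rule inj_onI)
      fix i j assume "i \<in> {..<length r}" "j \<in> {..<length r}" "?c i = ?c j"
      then have "length (drop i r) = length (drop j r)" "i < length r" "j < length r" by auto
      then show "i = j" by simp
    qed
  qed simp
  finally show ?thesis by simp
qed

lemma combination_mult_single:
  "combination_mult (Poly_Mapping.single (Path p) c) (Poly_Mapping.single (Path q) d) =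
     (if last p = hd q then Poly_Mapping.single (Path (p @ tl q)) (c * d) else 0)"
  unfolding combination_mult_def by (cases "c = 0"; cases "d = 0") auto

lemma lookup_combination_mult_Power:
  assumes "Poly_Mapping.keys f \<subseteq> range Path"
  shows "Poly_Mapping.lookup (combination_mult f g) (Power n) = 0"
proof -
  have "Poly_Mapping.lookup (case basis_mult x y of None \<Rightarrow> 0
      | Some z \<Rightarrow> Poly_Mapping.single z (c * d)) (Power n) = 0"
    if "x \<in> Poly_Mapping.keys f" for x y and c d :: 'b
    using that assms by (cases y) (auto simp: lookup_single when_def)
  then show ?thesis
    unfolding combination_mult_def lookup_sum by (auto intro!: sum.neutral)
qed

section \<open>The path algebra as a ring\<close>

lemma path_algebra_simps [simp]:
  "mult (path_algebra V E) = combination_mult"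
  "one (path_algebra V E) = (\<Sum>a\<in>V. path_elem [a])"
  "ring.zero (path_algebra V E) = 0"
  "add (path_algebra V E) = (+)"
  "smult (path_algebra V E) = (\<lambda>c f. Poly_Mapping.map (\<lambda>x. c * x) f)"
  "vertex_class (path_algebra V E) = (\<lambda>a. path_elem [a])"
  by (simp_all add: path_algebra_def basis_algebra_def)

lemma all_basis_iff: "(\<forall>x. P x) \<longleftrightarrow> (\<forall>n. P (Power n)) \<and> (\<forall>p. P (Path p))"
  by (metis basis.exhaust)

lemma carrier_path_algebra_iff:
  "f \<in> carrier (path_algebra V E) \<longleftrightarrow>
     (\<forall>n. Poly_Mapping.lookup f (Power n) = 0) \<and> (\<forall>p. coef f p \<noteq> 0 \<longrightarrow> graph_path V E p)"
proof -
  have "Poly_Mapping.keys f \<subseteq> Path ` {p. graph_path V E p} \<longleftrightarrow>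
     (\<forall>x. Poly_Mapping.lookup f x \<noteq> 0 \<longrightarrow> x \<in> Path ` {p. graph_path V E p})"
    by (auto simp: in_keys_iff)
  also have "\<dots> \<longleftrightarrow> (\<forall>n. Poly_Mapping.lookup f (Power n) = 0) \<and> (\<forall>p. coef f p \<noteq> 0 \<longrightarrow> graph_path V E p)"
    unfolding all_basis_iff by (auto simp: image_iff)
  finally show ?thesis
    by (simp add: path_algebra_def basis_algebra_def)
qed

lemma component_path_algebra_iff:
  "f \<in> component (path_algebra V E) n \<longleftrightarrow>
     f \<in> carrier (path_algebra V E) \<and> (\<forall>p. coef f p \<noteq> 0 \<longrightarrow> length p - 1 = n)"
proof -
  have "f \<in> component (path_algebra V E) n \<longleftrightarrow> f \<in> carrier (path_algebra V E) \<and>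
      (\<forall>x. Poly_Mapping.lookup f x \<noteq> 0 \<longrightarrow> basis_degree x = n)"
    by (auto simp: path_algebra_def basis_algebra_def in_keys_iff)
  also have "\<dots> \<longleftrightarrow> f \<in> carrier (path_algebra V E) \<and> (\<forall>p. coef f p \<noteq> 0 \<longrightarrow> length p - 1 = n)"
    unfolding all_basis_iff by (auto simp: carrier_path_algebra_iff)
  finally show ?thesis .
qed

text \<open>
  The following reduces identities in the path algebra to comparing coefficients at paths, where
  the convolution formula applies.
\<close>
lemma path_algebra_eqI:
  assumes "f \<in> carrier (path_algebra V E)" "g \<in> carrier (path_algebra V E)"
    and "\<And>p. coef f p = coef g p"
  shows "f = g"
proof (rule poly_mapping_eqI)
  show "Poly_Mapping.lookup f x = Poly_Mapping.lookup g x" for x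
    using assms by (cases x) (auto simp: carrier_path_algebra_iff)
qed

lemma coef_Nil: "f \<in> carrier (path_algebra V E) \<Longrightarrow> coef f [] = 0"
  by (auto simp: carrier_path_algebra_iff graph_path_def)

lemma path_vertices_subset: "f \<in> carrier (path_algebra V E) \<Longrightarrow> coef f p \<noteq> 0 \<Longrightarrow> set p \<subseteq> V"
  by (auto simp: carrier_path_algebra_iff graph_path_def)

lemmas coef_mult_path_algebra = coef_combination_mult[OF coef_Nil coef_Nil]

lemma graph_path_take_drop:
  assumes "graph_path V E (take (Suc i) r)" "graph_path V E (drop i r)" "i < length r"
  shows "graph_path V E r"
proof -
  have "r = take i r @ drop i r" by simp
  moreover have "successively (\<lambda>a b. {a, b} \<in> E) (take i r @ drop i r)"
    using assms
    by (subst successively_append_iff)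
      (auto simp: graph_path_def take_Suc_conv_app_nth successively_append_iff hd_drop_conv_nth)
  moreover have "set r \<subseteq> V"
  proof -
    have "set r = set (take i r) \<union> set (drop i r)" by (metis append_take_drop_id set_append)
    then show ?thesis using assms by (auto simp: graph_path_def take_Suc_conv_app_nth)
  qed
  ultimately show ?thesis using assms(3) by (auto simp: graph_path_def)
qed

lemma combination_mult_closed:
  assumes f: "f \<in> carrier (path_algebra V E)" and g: "g \<in> carrier (path_algebra V E)"
  shows "combination_mult f g \<in> carrier (path_algebra V E)"
  unfolding carrier_path_algebra_iff
proof (intro conjI allI impI)
  have "Poly_Mapping.keys f \<subseteq> range Path"
    using f by (auto simp: path_algebra_def basis_algebra_def)
  then show "Poly_Mapping.lookup (combination_mult f g) (Power n) = 0" for n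
    by (rule lookup_combination_mult_Power)
  fix p assume "coef (combination_mult f g) p \<noteq> 0"
  then obtain i where "i < length p" "coef f (take (Suc i) p) * coef g (drop i p) \<noteq> 0"
    unfolding coef_mult_path_algebra[OF f g] by (metis (no_types, lifting) lessThan_iff sum.neutral)
  then show "graph_path V E p"
    using f g unfolding carrier_path_algebra_iff
    by (metis graph_path_take_drop mult_zero_left mult_zero_right)
qed

lemma path_algebra_single_closed:
  "graph_path V E p \<Longrightarrow> Poly_Mapping.single (Path p) c \<in> carrier (path_algebra V E)"
  by (auto simp: carrier_path_algebra_iff lookup_single when_def)

lemma coef_one: "finite V \<Longrightarrow> coef (\<Sum>a\<in>V. path_elem [a]) p = (if length p = 1 \<and> hd p \<in> V then 1 else 0)"
  by (cases p; cases "tl p") (auto simp: lookup_sum lookup_single when_def)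

lemma path_algebra_one_closed:
  assumes "finite V"
  shows "(\<Sum>a\<in>V. path_elem [a]) \<in> carrier (path_algebra V E)"
  unfolding carrier_path_algebra_iff
proof (intro conjI allI impI)
  show "Poly_Mapping.lookup (\<Sum>a\<in>V. path_elem [a]) (Power n) = 0" for n
    by (simp add: lookup_sum lookup_single)
  show "graph_path V E p" if "coef (\<Sum>a\<in>V. path_elem [a]) p \<noteq> 0" for p
    using that assms by (cases p) (auto simp: coef_one graph_path_def split: if_splits)
qed

text \<open>
  Both sides sum over the ways to cut a path twice; the sides differ in which cut is made first.
\<close>
lemma combination_mult_assoc:
  assumes f: "f \<in> carrier (path_algebra V E)" and g: "g \<in> carrier (path_algebra V E)"
    and h: "h \<in> carrier (path_algebra V E)"
  shows "combination_mult (combination_mult f g) h = combination_mult f (combination_mult g h)"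
proof (rule path_algebra_eqI[of _ V E])
  fix p :: "'a list"
  let ?n = "length p"
  have "coef (combination_mult (combination_mult f g) h) p =
      (\<Sum>i<?n. coef (combination_mult f g) (take (Suc i) p) * coef h (drop i p))"
    by (rule coef_mult_path_algebra[OF combination_mult_closed[OF f g] h])
  also have "\<dots> = (\<Sum>i<?n. \<Sum>j<Suc i.
      coef f (take (Suc j) p) * coef g (drop j (take (Suc i) p)) * coef h (drop i p))"
  proof (intro sum.cong refl)
    fix i assume "i \<in> {..<?n}"
    then have "length (take (Suc i) p) = Suc i"
      by simp
    then show "coef (combination_mult f g) (take (Suc i) p) * coef h (drop i p) = (\<Sum>j<Suc i.
        coef f (take (Suc j) p) * coef g (drop j (take (Suc i) p)) * coef h (drop i p))"
      unfolding coef_mult_path_algebra[OF f g] sum_distrib_right by (intro sum.cong) (auto simp: min_def)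
  qed
  also have "\<dots> = (\<Sum>j<?n. \<Sum>i\<in>{j..<?n}.
      coef f (take (Suc j) p) * coef g (drop j (take (Suc i) p)) * coef h (drop i p))"
    unfolding sum.Sigma[OF finite_lessThan ballI[OF finite_lessThan]] sum.Sigma[OF finite_lessThan ballI[OF finite_atLeastLessThan]]
    by (rule sum.reindex_bij_witness[of _ "\<lambda>(j, i). (i, j)" "\<lambda>(i, j). (j, i)"]) auto
  also have "\<dots> = (\<Sum>j<?n. \<Sum>k<?n - j.
      coef f (take (Suc j) p) * (coef g (take (Suc k) (drop j p)) * coef h (drop k (drop j p))))"
  proof (rule sum.cong[OF refl])
    fix j assume "j \<in> {..<?n}"
    then show "(\<Sum>i\<in>{j..<?n}.
        coef f (take (Suc j) p) * coef g (drop j (take (Suc i) p)) * coef h (drop i p)) =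
      (\<Sum>k<?n - j.
        coef f (take (Suc j) p) * (coef g (take (Suc k) (drop j p)) * coef h (drop k (drop j p))))"
      by (intro sum.reindex_bij_witness[of _ "\<lambda>k. k + j" "\<lambda>i. i - j"])
        (auto simp: drop_take Suc_diff_le mult.assoc)
  qed
  also have "\<dots> = (\<Sum>j<?n. coef f (take (Suc j) p) * coef (combination_mult g h) (drop j p))"
    by (simp add: coef_mult_path_algebra[OF g h] sum_distrib_left)
  also have "\<dots> = coef (combination_mult f (combination_mult g h)) p"
    by (rule coef_mult_path_algebra[OF f combination_mult_closed[OF g h], symmetric])
  finally show "coef (combination_mult (combination_mult f g) h) p =
      coef (combination_mult f (combination_mult g h)) p" .
qed (use f g h combination_mult_closed in blast)+

lemma path_algebra_add_closed:
  "f \<in> carrier (path_algebra V E) \<Longrightarrow> g \<in> carrier (path_algebra V E) \<Longrightarrow>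
     f + g \<in> carrier (path_algebra V E)"
  unfolding carrier_path_algebra_iff lookup_add by (metis add_0)

text \<open>
  Multiplication by the idempotents \<open>[a]\<close> from both sides singles out the paths with given ends.
\<close>
lemma coef_vertex_mult:
  assumes f: "f \<in> carrier (path_algebra V E)" and a: "a \<in> V"
  shows "coef (combination_mult (path_elem [a]) f) p = (if hd p = a then coef f p else 0)"
proof -
  have v: "path_elem [a] \<in> carrier (path_algebra V E)"
    using a by (intro path_algebra_single_closed) (simp add: graph_path_def)
  show ?thesis
  proof (cases "p = []")
  case False
  have "coef (combination_mult (path_elem [a]) f) p =
      (\<Sum>i<length p. if i = 0 then (if hd p = a then coef f p else 0) else 0)"
    unfolding coef_mult_path_algebra[OF v f]
    by (intro sum.cong refl)
      (use False in \<open>auto simp: lookup_single when_def neq_Nil_conv dest: arg_cong[of _ _ length]\<close>)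
  also have "\<dots> = (if hd p = a then coef f p else 0)"
    using False by simp
  finally show ?thesis .
qed (use coef_Nil[OF f] coef_Nil[OF combination_mult_closed[OF v f]] in simp)
qed

lemma coef_mult_vertex:
  assumes f: "f \<in> carrier (path_algebra V E)" and a: "a \<in> V"
  shows "coef (combination_mult f (path_elem [a])) p = (if last p = a then coef f p else 0)"
proof -
  have v: "path_elem [a] \<in> carrier (path_algebra V E)"
    using a by (intro path_algebra_single_closed) (simp add: graph_path_def)
  show ?thesis
  proof (cases "p = []")
  case False
  have vertex: "(drop i p = [a]) = (i = length p - 1 \<and> last p = a)" if "i < length p" for i
  proof
    assume *: "drop i p = [a]"
    then have "length (drop i p) = 1" by simp
    moreover have "last (drop i p) = a" using * by simp
    ultimately show "i = length p - 1 \<and> last p = a" using that by (auto simp: last_drop)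
  next
    assume "i = length p - 1 \<and> last p = a"
    then show "drop i p = [a]"
      using False by (metis append_butlast_last_id append_eq_conv_conj length_butlast)
  qed
  have "coef (combination_mult f (path_elem [a])) p =
      (\<Sum>i<length p. if i = length p - 1 then (if last p = a then coef f p else 0) else 0)"
    unfolding coef_mult_path_algebra[OF f v]
  proof (rule sum.cong[OF refl])
    fix i assume "i \<in> {..<length p}"
    moreover have "coef (path_elem [a]) (drop i p) = (if drop i p = [a] then 1 else 0 :: 'b)"
      by (auto simp: lookup_single when_def)
    ultimately show "coef f (take (Suc i) p) * coef (path_elem [a]) (drop i p) =
        (if i = length p - 1 then if last p = a then coef f p else 0 else 0)"
      using vertex[of i] by auto
  qed
  also have "\<dots> = (if last p = a then coef f p else 0)"
    using False by simp
  finally show ?thesis .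
qed (use coef_Nil[OF f] coef_Nil[OF combination_mult_closed[OF f v]] in simp)
qed

lemma path_algebra_one_mult:
  assumes f: "f \<in> carrier (path_algebra V E)" and V: "finite V"
  shows "combination_mult (\<Sum>a\<in>V. path_elem [a]) f = f"
proof (rule path_algebra_eqI[of _ V E])
  fix p
  have "coef f p \<noteq> 0 \<Longrightarrow> hd p \<in> V"
    using path_vertices_subset[OF f] coef_Nil[OF f] by (metis hd_in_set subsetD)
  then have "coef (combination_mult (\<Sum>a\<in>V. path_elem [a]) f) p = (\<Sum>i<length p. if i = 0 then coef f p else 0)"
    unfolding coef_mult_path_algebra[OF path_algebra_one_closed[OF V] f] coef_one[OF V]
    by (intro sum.cong refl) auto
  then show "coef (combination_mult (\<Sum>a\<in>V. path_elem [a]) f) p = coef f p"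
    using coef_Nil[OF f] by (cases p) auto
qed (use f V combination_mult_closed path_algebra_one_closed in blast)+

lemma path_algebra_mult_one:
  assumes f: "f \<in> carrier (path_algebra V E)" and V: "finite V"
  shows "combination_mult f (\<Sum>a\<in>V. path_elem [a]) = f"
proof (rule path_algebra_eqI[of _ V E])
  fix p
  have "coef (combination_mult f (\<Sum>a\<in>V. path_elem [a])) p =
      (\<Sum>i<length p. if i = length p - 1 then coef f p else 0)"
    unfolding coef_mult_path_algebra[OF f path_algebra_one_closed[OF V]] coef_one[OF V]
    using path_vertices_subset[OF f, of p]
    by (intro sum.cong refl) (cases "coef f p = 0"; auto simp: hd_drop_conv_nth subset_iff)
  then show "coef (combination_mult f (\<Sum>a\<in>V. path_elem [a])) p = coef f p"
    using coef_Nil[OF f] by (cases p) auto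
qed (use f V combination_mult_closed path_algebra_one_closed in blast)+

lemma ring_path_algebra:
  assumes V: "finite V"
  shows "ring (path_algebra V E :: ('k::field, ('v, 'k) combination, 'v) graded_algebra)"
proof (rule ringI)
  let ?A = "path_algebra V E :: ('k, ('v, 'k) combination, 'v) graded_algebra"
  show "abelian_group ?A"
  proof (rule abelian_groupI)
    show "\<exists>y\<in>carrier ?A. y \<oplus>\<^bsub>?A\<^esub> x = \<zero>\<^bsub>?A\<^esub>" if "x \<in> carrier ?A" for x
      using that by (intro bexI[of _ "- x"]) (auto simp: carrier_path_algebra_iff)
  qed (auto simp: path_algebra_add_closed add.assoc add.commute carrier_path_algebra_iff[of 0])
  show "Group.monoid ?A"
    by (rule monoidI)
      (auto simp: combination_mult_closed path_algebra_one_closed V combination_mult_assoc path_algebra_one_mult path_algebra_mult_one)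
  fix x y z assume xyz: "x \<in> carrier ?A" "y \<in> carrier ?A" "z \<in> carrier ?A"
  show "(x \<oplus>\<^bsub>?A\<^esub> y) \<otimes>\<^bsub>?A\<^esub> z = x \<otimes>\<^bsub>?A\<^esub> z \<oplus>\<^bsub>?A\<^esub> y \<otimes>\<^bsub>?A\<^esub> z"
    using xyz
    by (intro path_algebra_eqI[of _ V E])
      (simp_all add: combination_mult_closed path_algebra_add_closed coef_mult_path_algebra[OF path_algebra_add_closed[OF xyz(1,2)] xyz(3)]
        coef_mult_path_algebra[of _ V E _ V E] lookup_add sum.distrib algebra_simps)
  show "z \<otimes>\<^bsub>?A\<^esub> (x \<oplus>\<^bsub>?A\<^esub> y) = z \<otimes>\<^bsub>?A\<^esub> x \<oplus>\<^bsub>?A\<^esub> z \<otimes>\<^bsub>?A\<^esub> y"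
    using xyz
    by (intro path_algebra_eqI[of _ V E])
      (simp_all add: combination_mult_closed path_algebra_add_closed coef_mult_path_algebra[OF xyz(3) path_algebra_add_closed[OF xyz(1,2)]]
        coef_mult_path_algebra[of _ V E _ V E] lookup_add sum.distrib algebra_simps)
qed

section \<open>Isomorphisms of quotient algebras\<close>

lemma quotient_algebra_simps:
  "carrier (quotient_algebra A I) = (\<lambda>x. I +>\<^bsub>A\<^esub> x) ` carrier A"
  "mult (quotient_algebra A I) = rcoset_mult A I"
  "one (quotient_algebra A I) = I +>\<^bsub>A\<^esub> \<one>\<^bsub>A\<^esub>"
  "add (quotient_algebra A I) = set_add A"
  "smult (quotient_algebra A I) = (\<lambda>c X. \<Union>x\<in>X. I +>\<^bsub>A\<^esub> (c \<odot>\<^bsub>A\<^esub> x))"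
  "component (quotient_algebra A I) n = (\<lambda>x. I +>\<^bsub>A\<^esub> x) ` component A n"
  "vertex_class (quotient_algebra A I) = (\<lambda>a. I +>\<^bsub>A\<^esub> vertex_class A a)"
  by (auto simp: quotient_algebra_def FactRing_simps)

lemma graded_algebra_isoD:
  assumes "F \<in> graded_algebra_iso A B"
  shows "F \<in> ring_hom A B" "bij_betw F (carrier A) (carrier B)"
    "\<And>c x. x \<in> carrier A \<Longrightarrow> F (c \<odot>\<^bsub>A\<^esub> x) = c \<odot>\<^bsub>B\<^esub> F x"
    "\<And>n. F ` component A n = component B n"
  using assms by (auto simp: graded_algebra_iso_def ring_iso_def)

text \<open>
  Because the elements of a quotient are sets, the map induced by \<open>F\<close> is taking images under \<open>F\<close>.
\<close>
lemma image_coset: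
  assumes I: "I \<subseteq> carrier A" and F: "F \<in> ring_hom A B" and x: "x \<in> carrier A"
  shows "F ` (I +>\<^bsub>A\<^esub> x) = F ` I +>\<^bsub>B\<^esub> F x"
proof -
  have "F ` (I +>\<^bsub>A\<^esub> x) = (\<lambda>i. F (i \<oplus>\<^bsub>A\<^esub> x)) ` I"
    by (auto simp: a_r_coset_def r_coset_def)
  also have "\<dots> = (\<lambda>i. F i \<oplus>\<^bsub>B\<^esub> F x) ` I"
    using I by (intro image_cong refl) (auto intro!: ring_hom_add[OF F] x)
  also have "\<dots> = F ` I +>\<^bsub>B\<^esub> F x"
    by (auto simp: a_r_coset_def r_coset_def)
  finally show ?thesis .
qed

lemma quotient_algebra_iso:
  assumes I: "ideal I A" and J: "ideal J B"
    and F: "F \<in> graded_algebra_iso A B" and FI: "F ` I = J"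
    and smult: "\<And>c x. x \<in> carrier A \<Longrightarrow> c \<odot>\<^bsub>A\<^esub> x \<in> carrier A"
    and comp: "\<And>n. component A n \<subseteq> carrier A"
  shows "image F \<in> graded_algebra_iso (quotient_algebra A I) (quotient_algebra B J)"
proof -
  interpret I: ideal I A by (rule I)
  interpret J: ideal J B by (rule J)
  note Fhom = graded_algebra_isoD(1)[OF F]
  note Fbij = graded_algebra_isoD(2)[OF F]
  have coset: "F ` (I +>\<^bsub>A\<^esub> x) = J +>\<^bsub>B\<^esub> F x" if "x \<in> carrier A" for x
    using image_coset[OF I.a_subset Fhom that] by (simp add: FI)
  have Fcl: "F x \<in> carrier B" if "x \<in> carrier A" for x
    using Fhom that by (rule ring_hom_closed)
  have sub: "I +>\<^bsub>A\<^esub> x \<subseteq> carrier A" if "x \<in> carrier A" for x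
    by (intro I.a_r_coset_subset_G I.a_subset that)
  have hom: "image F \<in> ring_hom (quotient_algebra A I) (quotient_algebra B J)"
  proof (rule ring_hom_memI)
    fix X Y assume "X \<in> carrier (quotient_algebra A I)" "Y \<in> carrier (quotient_algebra A I)"
    then obtain x y where x: "x \<in> carrier A" "X = I +>\<^bsub>A\<^esub> x" and y: "y \<in> carrier A" "Y = I +>\<^bsub>A\<^esub> y"
      by (auto simp: quotient_algebra_simps)
    show "F ` (X \<otimes>\<^bsub>quotient_algebra A I\<^esub> Y) = F ` X \<otimes>\<^bsub>quotient_algebra B J\<^esub> F ` Y"
      by (simp add: quotient_algebra_simps x y I.rcoset_mult_add J.rcoset_mult_add coset Fcl ring_hom_mult[OF Fhom])
    show "F ` (X \<oplus>\<^bsub>quotient_algebra A I\<^esub> Y) = F ` X \<oplus>\<^bsub>quotient_algebra B J\<^esub> F ` Y"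
      by (simp add: quotient_algebra_simps x y I.a_rcos_sum J.a_rcos_sum coset Fcl ring_hom_add[OF Fhom])
  qed (auto simp: quotient_algebra_simps coset Fcl ring_hom_one[OF Fhom])
  have bij: "bij_betw (image F) (carrier (quotient_algebra A I)) (carrier (quotient_algebra B J))"
  proof (rule bij_betw_imageI)
    show "inj_on (image F) (carrier (quotient_algebra A I))"
      by (rule inj_onI) (use Fbij sub in \<open>auto simp: quotient_algebra_simps bij_betw_def inj_on_image_eq_iff\<close>)
    have "image F ` carrier (quotient_algebra A I) = (\<lambda>x. J +>\<^bsub>B\<^esub> F x) ` carrier A"
      by (auto simp: quotient_algebra_simps image_image coset)
    also have "\<dots> = (\<lambda>y. J +>\<^bsub>B\<^esub> y) ` F ` carrier A"
      by (simp add: image_image)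
    finally show "image F ` carrier (quotient_algebra A I) = carrier (quotient_algebra B J)"
      using Fbij by (simp add: quotient_algebra_simps bij_betw_def)
  qed
  have "F ` (c \<odot>\<^bsub>quotient_algebra A I\<^esub> X) = c \<odot>\<^bsub>quotient_algebra B J\<^esub> F ` X"
    if "X \<in> carrier (quotient_algebra A I)" for c X
  proof -
    have X: "X \<subseteq> carrier A"
      using that sub by (auto simp: quotient_algebra_simps)
    have "F ` (c \<odot>\<^bsub>quotient_algebra A I\<^esub> X) = (\<Union>x\<in>X. F ` (I +>\<^bsub>A\<^esub> (c \<odot>\<^bsub>A\<^esub> x)))"
      by (auto simp: quotient_algebra_simps)
    also have "\<dots> = (\<Union>x\<in>X. J +>\<^bsub>B\<^esub> (c \<odot>\<^bsub>B\<^esub> F x))"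
    proof (rule SUP_cong[OF refl])
      fix x assume "x \<in> X"
      then have "x \<in> carrier A"
        using X by blast
      then show "F ` (I +>\<^bsub>A\<^esub> (c \<odot>\<^bsub>A\<^esub> x)) = J +>\<^bsub>B\<^esub> (c \<odot>\<^bsub>B\<^esub> F x)"
        using coset[OF smult] graded_algebra_isoD(3)[OF F] by simp
    qed
    finally show ?thesis
      by (simp add: quotient_algebra_simps)
  qed
  moreover have "image F ` component (quotient_algebra A I) n = component (quotient_algebra B J) n" for n
  proof -
    have "image F ` component (quotient_algebra A I) n = (\<lambda>x. J +>\<^bsub>B\<^esub> F x) ` component A n"
      unfolding quotient_algebra_simps image_image
      by (intro image_cong refl) (use comp coset in blast)
    also have "\<dots> = (\<lambda>y. J +>\<^bsub>B\<^esub> y) ` F ` component A n"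
      by (simp add: image_image)
    finally show ?thesis
      by (simp add: quotient_algebra_simps graded_algebra_isoD(4)[OF F])
  qed
  ultimately show ?thesis
    using hom bij by (auto simp: graded_algebra_iso_def ring_iso_def)
qed

lemma vertex_preserving_isomorphic_refl: "vertex_preserving_isomorphic V A A"
  unfolding vertex_preserving_isomorphic_def graded_algebra_iso_def ring_iso_def ring_hom_def
  by (intro bexI[of _ "\<lambda>x. x"]) (auto simp: bij_betw_def)

section \<open>Rescaling the edges\<close>

text \<open>
  Multiplying each edge by its own scalar multiplies a path by the product of the scalars along it.
  As cutting a path distributes its edges among the two parts, this is multiplicative.
\<close>
fun path_weight :: "('v \<Rightarrow> 'v \<Rightarrow> 'k::field) \<Rightarrow> 'v list \<Rightarrow> 'k" where
  "path_weight t (a # b # p) = t a b * path_weight t (b # p)"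
| "path_weight t _ = 1"

lemma path_weight_split:
  "i < length p \<Longrightarrow> path_weight t p = path_weight t (take (Suc i) p) * path_weight t (drop i p)"
proof (induction t p arbitrary: i rule: path_weight.induct)
  case (1 t a b p)
  then show ?case
    by (cases i) (auto simp: mult.assoc)
qed auto

fun basis_weight :: "('v \<Rightarrow> 'v \<Rightarrow> 'k::field) \<Rightarrow> 'v basis \<Rightarrow> 'k" where
  "basis_weight t (Path p) = path_weight t p"
| "basis_weight t (Power n) = 1"

definition rescale :: "('v \<Rightarrow> 'v \<Rightarrow> 'k::field) \<Rightarrow> ('v, 'k) combination \<Rightarrow> ('v, 'k) combination" where
  "rescale t f = Poly_Mapping.mapp (\<lambda>x c. basis_weight t x * c) f"

lemma lookup_rescale: "Poly_Mapping.lookup (rescale t f) x = basis_weight t x * Poly_Mapping.lookup f x"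
  by (simp add: rescale_def lookup_mapp when_def in_keys_iff)

lemma lookup_scale:
  "Poly_Mapping.lookup (Poly_Mapping.map (\<lambda>x. c * x) f) x = c * Poly_Mapping.lookup f x" for c :: "'k::field"
  by (simp add: Poly_Mapping.map.rep_eq when_def)

lemma rescale_single:
  "rescale t (Poly_Mapping.single (Path p) c) = Poly_Mapping.single (Path p) (path_weight t p * c)"
  by (rule poly_mapping_eqI) (auto simp: lookup_rescale lookup_single when_def)

lemma path_algebra_rescale_closed: "f \<in> carrier (path_algebra V E) \<Longrightarrow> rescale t f \<in> carrier (path_algebra V E)"
  unfolding carrier_path_algebra_iff lookup_rescale by (metis mult_zero_right)

lemma path_algebra_scale_closed:
  "f \<in> carrier (path_algebra V E) \<Longrightarrow> Poly_Mapping.map (\<lambda>x. c * x) f \<in> carrier (path_algebra V E)"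
  for c :: "'k::field"
  unfolding carrier_path_algebra_iff lookup_scale by (metis mult_zero_right)

lemma path_weight_nonzero:
  assumes "\<And>a b. {a, b} \<in> E \<Longrightarrow> t a b \<noteq> 0" and "successively (\<lambda>a b. {a, b} \<in> E) p"
  shows "path_weight t p \<noteq> 0"
  using assms(2) by (induction p rule: induct_list012) (auto simp: assms(1))

lemma path_weight_inverse:
  "path_weight (\<lambda>a b. inverse (t a b)) p = inverse (path_weight t p)"
  by (induction p rule: induct_list012) auto

lemma rescale_mult:
  assumes f: "f \<in> carrier (path_algebra V E)" and g: "g \<in> carrier (path_algebra V E)"
  shows "rescale t (combination_mult f g) = combination_mult (rescale t f) (rescale t g)"
proof (rule path_algebra_eqI[of _ V E])
  fix p
  show "coef (rescale t (combination_mult f g)) p = coef (combination_mult (rescale t f) (rescale t g)) p"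
    unfolding lookup_rescale coef_mult_path_algebra[OF f g] coef_mult_path_algebra[OF path_algebra_rescale_closed[OF f] path_algebra_rescale_closed[OF g]]
      sum_distrib_left
    by (intro sum.cong refl) (simp add: path_weight_split mult_ac)
qed (intro path_algebra_rescale_closed combination_mult_closed f g)+

lemma rescale_inverse:
  assumes "\<And>a b. {a, b} \<in> E \<Longrightarrow> t a b \<noteq> 0" "f \<in> carrier (path_algebra V E)"
  shows "rescale (\<lambda>a b. inverse (t a b)) (rescale t f) = f"
proof (rule path_algebra_eqI[of _ V E])
  fix p
  have "coef f p \<noteq> 0 \<longrightarrow> path_weight t p \<noteq> 0"
    using assms(2) path_weight_nonzero[of E t p, OF assms(1)]
    unfolding carrier_path_algebra_iff graph_path_def by blast
  then show "coef (rescale (\<lambda>a b. inverse (t a b)) (rescale t f)) p = coef f p"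
    by (auto simp: lookup_rescale path_weight_inverse)
qed (intro path_algebra_rescale_closed assms)+

lemma rescale_inverse':
  assumes "\<And>a b. {a, b} \<in> E \<Longrightarrow> t a b \<noteq> 0" "f \<in> carrier (path_algebra V E)"
  shows "rescale t (rescale (\<lambda>a b. inverse (t a b)) f) = f"
  using rescale_inverse[of E "\<lambda>a b. inverse (t a b)" f V] assms by simp

lemma rescale_one:
  assumes "finite V"
  shows "rescale t (\<Sum>a\<in>V. path_elem [a]) = (\<Sum>a\<in>V. path_elem [a])"
proof (rule path_algebra_eqI[of _ V "{}"])
  show "coef (rescale t (\<Sum>a\<in>V. path_elem [a])) p = coef (\<Sum>a\<in>V. path_elem [a]) p" for p
    unfolding lookup_rescale coef_one[OF assms] by (cases p; cases "tl p") auto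
qed (intro path_algebra_rescale_closed path_algebra_one_closed assms)+

lemma rescale_add: "rescale t (f + g) = rescale t f + rescale t g"
  by (rule poly_mapping_eqI) (simp add: lookup_rescale lookup_add distrib_left)

lemma rescale_hom:
  assumes "finite V"
  shows "rescale t \<in> ring_hom (path_algebra V E) (path_algebra V E)"
  by (rule ring_hom_memI) (simp_all add: path_algebra_rescale_closed rescale_mult[of _ V E] rescale_add rescale_one assms)

lemma rescale_iso:
  fixes t :: "'v \<Rightarrow> 'v \<Rightarrow> 'k::field"
  assumes V: "finite V" and t: "\<And>a b. {a, b} \<in> E \<Longrightarrow> t a b \<noteq> 0"
  shows "rescale t \<in> graded_algebra_iso (path_algebra V E) (path_algebra V E)"
proof -
  let ?s = "\<lambda>a b. inverse (t a b)"
  have "bij_betw (rescale t) (carrier (path_algebra V E)) (carrier (path_algebra V E))"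
    by (rule bij_betwI[of _ _ _ "rescale ?s"])
      (auto simp: path_algebra_rescale_closed rescale_inverse[of E t _ V, OF t] rescale_inverse'[of E t _ V, OF t])
  moreover have comp: "rescale s f \<in> component (path_algebra V E) n" if "f \<in> component (path_algebra V E) n"
    for s :: "'v \<Rightarrow> 'v \<Rightarrow> 'k" and f n
    using that unfolding component_path_algebra_iff by (auto simp: lookup_rescale path_algebra_rescale_closed)
  moreover have "rescale t ` component (path_algebra V E) n = component (path_algebra V E) n" for n
  proof (intro equalityI subsetI)
    fix f :: "('v, 'k) combination" assume f: "f \<in> component (path_algebra V E) n"
    then have "f = rescale t (rescale ?s f)"
      using rescale_inverse'[of E t _ V, OF t] by (simp add: component_path_algebra_iff)
    then show "f \<in> rescale t ` component (path_algebra V E) n"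
      using comp[OF f] by blast
  qed (use comp in blast)
  moreover have "rescale t (Poly_Mapping.map (\<lambda>x. c * x) f) = Poly_Mapping.map (\<lambda>x. c * x) (rescale t f)"
    for c :: 'k and f
    by (rule poly_mapping_eqI) (simp add: lookup_rescale lookup_scale)
  ultimately show ?thesis
    by (auto simp: graded_algebra_iso_def ring_iso_def rescale_hom V)
qed

section \<open>The skew-zigzag ideal\<close>

text \<open>
  The number \<open>m a b\<close> is the factor by which an isomorphism from \<open>A\<^sub>v\<close> to \<open>A\<^sub>u\<close> scales the loop
  \<open>(a | b | a)\<close>.  The loops \<open>(a | b | a)\<close> and \<open>(b | a | b)\<close> run through the same two directed edges,
  hence the symmetry.
\<close>
definition same_up_to_rescaling ::
  "'v set set \<Rightarrow> ('v \<Rightarrow> 'v \<Rightarrow> 'v \<Rightarrow> 'k::field) \<Rightarrow> ('v \<Rightarrow> 'v \<Rightarrow> 'v \<Rightarrow> 'k) \<Rightarrow> bool" where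
  "same_up_to_rescaling E v u \<longleftrightarrow> (\<exists>m.
     (\<forall>a b. {a, b} \<in> E \<longrightarrow> m a b \<noteq> 0 \<and> m a b = m b a) \<and>
     (\<forall>a b c. {a, b} \<in> E \<and> {a, c} \<in> E \<longrightarrow> u a b c * m a b = v a b c * m a c))"

abbreviation skew_zigzag_ideal ::
  "'v set \<Rightarrow> 'v set set \<Rightarrow> ('v \<Rightarrow> 'v \<Rightarrow> 'v \<Rightarrow> 'k::field) \<Rightarrow> ('v, 'k) combination set" where
  "skew_zigzag_ideal V E v \<equiv> Idl\<^bsub>path_algebra V E\<^esub> (skew_zigzag_relations E v)"

lemma simple_graph_edgeD:
  assumes "simple_graph V E" "{a, b} \<in> E"
  shows "a \<in> V" "b \<in> V" "a \<noteq> b" "{b, a} \<in> E"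
proof -
  have "{a, b} \<subseteq> V" "card {a, b} = 2"
    using assms by (auto simp: simple_graph_def)
  then show "a \<in> V" "b \<in> V" "a \<noteq> b" by auto
  show "{b, a} \<in> E" using assms(2) by (simp add: insert_commute)
qed

lemma simple_graph_finite_neighbours: "simple_graph V E \<Longrightarrow> finite {b. {a, b} \<in> E}"
  by (rule finite_subset[of _ V]) (use simple_graph_edgeD(2) in \<open>auto simp: simple_graph_def\<close>)

lemma path_algebra_diff_closed:
  assumes "f \<in> carrier (path_algebra V E)" "g \<in> carrier (path_algebra V E)"
  shows "f - g \<in> carrier (path_algebra V E)"
  using assms unfolding carrier_path_algebra_iff lookup_minus by (metis diff_0_right)

lemma skew_zigzag_relations_closed:
  assumes "simple_graph V E"
  shows "skew_zigzag_relations E v \<subseteq> carrier (path_algebra V E)"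
proof
  have path: "graph_path V E [a, b, c]" if "{a, b} \<in> E" "{b, c} \<in> E" for a b c
    using that simple_graph_edgeD(1,2)[OF assms that(1)] simple_graph_edgeD(2)[OF assms that(2)] by (simp add: graph_path_def)
  fix f assume "f \<in> skew_zigzag_relations E v"
  then show "f \<in> carrier (path_algebra V E)"
    unfolding skew_zigzag_relations_def
    by (elim UnE CollectE exE conjE) (auto intro!: path_algebra_single_closed path_algebra_diff_closed path dest: simple_graph_edgeD(4)[OF assms])
qed

lemma simple_graph_ring_path_algebra: "simple_graph V E \<Longrightarrow> ring (path_algebra V E)"
  by (simp add: ring_path_algebra simple_graph_def)

lemma ideal_skew_zigzag_ideal:
  assumes "simple_graph V E"
  shows "ideal (skew_zigzag_ideal V E v) (path_algebra V E)"
  by (intro ring.genideal_ideal simple_graph_ring_path_algebra skew_zigzag_relations_closed assms)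

lemma a_inv_path_algebra:
  assumes "finite V" "f \<in> carrier (path_algebra V E)"
  shows "\<ominus>\<^bsub>path_algebra V E\<^esub> f = - f"
proof -
  interpret ring "path_algebra V E" by (rule ring_path_algebra[OF assms(1)])
  have "- f \<in> carrier (path_algebra V E)"
    using assms(2) by (simp add: carrier_path_algebra_iff)
  then show ?thesis
    using assms(2) by (intro minus_equality) auto
qed

lemma path_algebra_coset_eq_iff:
  assumes "finite V" and I: "ideal I (path_algebra V E)"
    and x: "x \<in> carrier (path_algebra V E)" and y: "y \<in> carrier (path_algebra V E)"
  shows "I +>\<^bsub>path_algebra V E\<^esub> x = I +>\<^bsub>path_algebra V E\<^esub> y \<longleftrightarrow> x - y \<in> I"
proof -
  interpret I: ideal I "path_algebra V E" by (rule I)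
  have mem: "x \<in> I +>\<^bsub>path_algebra V E\<^esub> y \<longleftrightarrow> x - y \<in> I"
    by (auto simp: a_r_coset_def r_coset_def) (metis diff_add_cancel)
  show ?thesis
    using I.a_rcos_self[OF x] I.a_repr_independence'[OF _ y] mem by metis
qed

lemma scale_combination_mult:
  fixes c :: "'k::field"
  assumes f: "f \<in> carrier (path_algebra V E)" and g: "g \<in> carrier (path_algebra V E)"
  shows "combination_mult (Poly_Mapping.map (\<lambda>y. c * y) f) g =
    Poly_Mapping.map (\<lambda>y. c * y) (combination_mult f g)"
proof (rule path_algebra_eqI[of _ V E])
  show "coef (combination_mult (Poly_Mapping.map (\<lambda>y. c * y) f) g) p =
      coef (Poly_Mapping.map (\<lambda>y. c * y) (combination_mult f g)) p" for p
    unfolding lookup_scale coef_mult_path_algebra[OF f g] coef_mult_path_algebra[OF path_algebra_scale_closed[OF f] g] sum_distrib_left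
    by (simp add: mult.assoc)
qed (intro path_algebra_scale_closed combination_mult_closed f g)+

text \<open>
  Ideals are only required to absorb products, but a scalar multiple is a product with a scalar
  multiple of the unit.
\<close>
lemma smult_in_ideal:
  fixes c :: "'k::field"
  assumes V: "finite V" and I: "ideal I (path_algebra V E)" and x: "x \<in> I"
  shows "Poly_Mapping.map (\<lambda>y. c * y) x \<in> I"
proof -
  interpret I: ideal I "path_algebra V E" by (rule I)
  let ?c = "Poly_Mapping.map (\<lambda>y. c * y) (\<Sum>a\<in>V. path_elem [a])"
  have c: "?c \<in> carrier (path_algebra V E)"
    by (intro path_algebra_scale_closed path_algebra_one_closed V)
  have x': "x \<in> carrier (path_algebra V E)"
    using x by (rule I.a_Hcarr)
  have "combination_mult ?c x = Poly_Mapping.map (\<lambda>y. c * y) (combination_mult (\<Sum>a\<in>V. path_elem [a]) x)"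
    by (rule scale_combination_mult[OF path_algebra_one_closed[OF V] x'])
  also have "\<dots> = Poly_Mapping.map (\<lambda>y. c * y) x"
    by (simp add: path_algebra_one_mult[OF x' V])
  finally show ?thesis
    using I.I_l_closed[OF x c] by simp
qed

lemma smult_coset:
  fixes c :: "'k::field"
  assumes V: "finite V" and I: "ideal I (path_algebra V E)" and x: "x \<in> carrier (path_algebra V E)"
  shows "c \<odot>\<^bsub>quotient_algebra (path_algebra V E) I\<^esub> (I +>\<^bsub>path_algebra V E\<^esub> x) =
    I +>\<^bsub>path_algebra V E\<^esub> Poly_Mapping.map (\<lambda>y. c * y) x"
proof -
  interpret I: ideal I "path_algebra V E" by (rule I)
  have "I +>\<^bsub>path_algebra V E\<^esub> Poly_Mapping.map (\<lambda>y. c * y) x' =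
      I +>\<^bsub>path_algebra V E\<^esub> Poly_Mapping.map (\<lambda>y. c * y) x"
    if "x' \<in> I +>\<^bsub>path_algebra V E\<^esub> x" for x'
  proof -
    have x': "x' \<in> carrier (path_algebra V E)"
      using I.a_r_coset_subset_G[OF I.a_subset x] that by blast
    have "I +>\<^bsub>path_algebra V E\<^esub> x' = I +>\<^bsub>path_algebra V E\<^esub> x"
      using I.a_repr_independence'[OF that x] by simp
    then have "x' - x \<in> I"
      using path_algebra_coset_eq_iff[OF V I x' x] by simp
    then have "Poly_Mapping.map (\<lambda>y. c * y) (x' - x) \<in> I"
      by (rule smult_in_ideal[OF V I])
    moreover have "Poly_Mapping.map (\<lambda>y. c * y) (x' - x) =
        Poly_Mapping.map (\<lambda>y. c * y) x' - Poly_Mapping.map (\<lambda>y. c * y) x"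
      by (rule poly_mapping_eqI) (simp add: lookup_scale lookup_minus right_diff_distrib)
    ultimately show ?thesis
      using path_algebra_coset_eq_iff[OF V I path_algebra_scale_closed[OF x'] path_algebra_scale_closed[OF x]] by simp
  qed
  then have "(\<Union>x'\<in>I +>\<^bsub>path_algebra V E\<^esub> x. I +>\<^bsub>path_algebra V E\<^esub> Poly_Mapping.map (\<lambda>y. c * y) x') =
      (\<Union>x'\<in>I +>\<^bsub>path_algebra V E\<^esub> x. I +>\<^bsub>path_algebra V E\<^esub> Poly_Mapping.map (\<lambda>y. c * y) x)"
    by (rule SUP_cong[OF refl])
  moreover have "I +>\<^bsub>path_algebra V E\<^esub> x \<noteq> {}"
    using I.a_rcos_self[OF x] by blast
  ultimately show ?thesis
    unfolding quotient_algebra_simps path_algebra_simps by simp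
qed

section \<open>Isomorphisms from rescalings\<close>

lemma rescale_diff: "rescale t (f - g) = rescale t f - rescale t g"
  by (rule poly_mapping_eqI) (simp add: lookup_rescale lookup_minus right_diff_distrib)

text \<open>
  Paths \<open>(a | b | c)\<close> with \<open>a \<noteq> c\<close> are mapped to multiples of themselves; in a relation between two
  loops at \<open>a\<close>, the hypothesis turns the coefficient \<open>v a b c\<close> into \<open>u a b c\<close>.
\<close>
lemma rescale_ideal_subset:
  assumes G: "simple_graph V E"
    and t: "\<And>a b c. {a, b} \<in> E \<Longrightarrow> {a, c} \<in> E \<Longrightarrow>
      u a b c * (t a b * t b a) = v a b c * (t a c * t c a)"
  shows "rescale t ` skew_zigzag_ideal V E v \<subseteq> skew_zigzag_ideal V E u"
proof -
  let ?A = "path_algebra V E" and ?J = "skew_zigzag_ideal V E u"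
  have V: "finite V" using G by (simp add: simple_graph_def)
  interpret A: ring ?A by (rule simple_graph_ring_path_algebra[OF G])
  have J: "ideal ?J ?A" by (rule ideal_skew_zigzag_ideal[OF G])
  have sub: "skew_zigzag_relations E u \<subseteq> ?J"
    by (intro A.genideal_self skew_zigzag_relations_closed G)
  have "ideal {f \<in> carrier ?A. rescale t f \<in> ?J} ?A"
    by (rule ring_hom_ring.ideal_vimage[OF ring_hom_ringI2[OF A.ring_axioms A.ring_axioms rescale_hom[OF V]] J])
  moreover have "rescale t f \<in> ?J" if f: "f \<in> skew_zigzag_relations E v" for f
    using f[unfolded skew_zigzag_relations_def]
  proof (elim UnE CollectE exE conjE)
    fix a b c assume f: "f = path_elem [a, b, c]" and abc: "{a, b} \<in> E" "{b, c} \<in> E" "a \<noteq> c"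
    have "path_elem [a, b, c] \<in> ?J"
      using abc sub by (force simp: skew_zigzag_relations_def)
    moreover have "rescale t f = Poly_Mapping.map (\<lambda>y. path_weight t [a, b, c] * y) (path_elem [a, b, c])"
      unfolding f rescale_single by (rule poly_mapping_eqI) (simp add: lookup_scale lookup_single when_def)
    ultimately show "rescale t f \<in> ?J"
      using smult_in_ideal[OF V J] by metis
  next
    fix a b c assume f: "f = path_elem [a, b, a] - Poly_Mapping.single (Path [a, c, a]) (v a b c)"
      and abc: "{a, b} \<in> E" "{a, c} \<in> E"
    let ?r = "path_elem [a, b, a] - Poly_Mapping.single (Path [a, c, a]) (u a b c)"
    have "?r \<in> ?J"
      using abc sub by (force simp: skew_zigzag_relations_def)
    moreover have "rescale t f = Poly_Mapping.map (\<lambda>y. (t a b * t b a) * y) ?r"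
      unfolding f rescale_diff rescale_single
      by (rule poly_mapping_eqI, unfold lookup_scale lookup_minus lookup_single)
        (use t[OF abc] in \<open>auto simp: when_def algebra_simps\<close>)
    ultimately show "rescale t f \<in> ?J"
      using smult_in_ideal[OF V J, of ?r "t a b * t b a"] by argo
  qed
  ultimately have "skew_zigzag_ideal V E v \<subseteq> {f \<in> carrier ?A. rescale t f \<in> ?J}"
    using skew_zigzag_relations_closed[OF G] by (intro A.genideal_minimal) auto
  then show ?thesis by auto
qed

lemma rescaling_imp_isomorphic:
  fixes v u :: "'v \<Rightarrow> 'v \<Rightarrow> 'v \<Rightarrow> 'k::field"
  assumes sqrt: "\<forall>x::'k. \<exists>y. y ^ 2 = x" and G: "simple_graph V E"
    and vu: "same_up_to_rescaling E v u"
  shows "vertex_preserving_isomorphic V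
    (quotient_algebra (path_algebra V E) (skew_zigzag_ideal V E v))
    (quotient_algebra (path_algebra V E) (skew_zigzag_ideal V E u))"
proof -
  let ?A = "path_algebra V E :: ('k, ('v, 'k) combination, 'v) graded_algebra"
  have V: "finite V" using G by (simp add: simple_graph_def)
  obtain m where m: "\<And>a b. {a, b} \<in> E \<Longrightarrow> m a b \<noteq> 0" "\<And>a b. {a, b} \<in> E \<Longrightarrow> m a b = m b a"
    and vum: "\<And>a b c. {a, b} \<in> E \<Longrightarrow> {a, c} \<in> E \<Longrightarrow> u a b c * m a b = v a b c * m a c"
    using vu unfolding same_up_to_rescaling_def by blast
  obtain s where s: "\<And>x::'k. s x ^ 2 = x"
    using sqrt by metis
  define t where "t a b = s (m a b)" for a b
  define t' where "t' a b = inverse (t a b)" for a b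
  have tm: "t a b * t b a = m a b" if "{a, b} \<in> E" for a b
    using m(2)[OF that] s[of "m a b"] by (simp add: t_def power2_eq_square)
  have t0: "t a b \<noteq> 0" if "{a, b} \<in> E" for a b
    using tm[OF that] m(1)[OF that] by auto
  have le: "rescale t ` skew_zigzag_ideal V E v \<subseteq> skew_zigzag_ideal V E u"
    by (rule rescale_ideal_subset[OF G]) (simp add: tm vum)
  (* The condition is symmetric under inverting the scalars, so the inverse map goes back. *)
  have "rescale t' ` skew_zigzag_ideal V E u \<subseteq> skew_zigzag_ideal V E v"
  proof (rule rescale_ideal_subset[OF G])
    fix a b c assume e: "{a, b} \<in> E" "{a, c} \<in> E"
    have "v a b c * inverse (m a b) = u a b c * inverse (m a c)"
      using vum[OF e] m(1)[OF e(1)] m(1)[OF e(2)] by (simp add: field_simps)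
    moreover have "t' a b * t' b a = inverse (m a b)" "t' a c * t' c a = inverse (m a c)"
      unfolding t'_def by (simp_all add: tm[symmetric] e mult.commute)
    ultimately show "v a b c * (t' a b * t' b a) = u a b c * (t' a c * t' c a)"
      by simp
  qed
  then have "rescale t ` rescale t' ` skew_zigzag_ideal V E u \<subseteq> rescale t ` skew_zigzag_ideal V E v"
    by (rule image_mono)
  moreover have "rescale t (rescale t' f) = f" if "f \<in> skew_zigzag_ideal V E u" for f
  proof -
    have "f \<in> carrier ?A"
      using ideal_skew_zigzag_ideal[OF G, of u] that
      by (meson additive_subgroup.a_Hcarr ideal.axioms(1))
    then show ?thesis
      unfolding t'_def by (intro rescale_inverse'[of E t _ V] t0)
  qed
  ultimately have eq: "rescale t ` skew_zigzag_ideal V E v = skew_zigzag_ideal V E u"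
    using le by (force simp: image_image)
  have "image (rescale t) \<in> graded_algebra_iso
      (quotient_algebra ?A (skew_zigzag_ideal V E v)) (quotient_algebra ?A (skew_zigzag_ideal V E u))"
    by (rule quotient_algebra_iso[OF ideal_skew_zigzag_ideal[OF G] ideal_skew_zigzag_ideal[OF G]
          rescale_iso[OF V t0] eq])
      (auto simp: path_algebra_scale_closed component_path_algebra_iff)
  moreover have "rescale t ` (skew_zigzag_ideal V E v +>\<^bsub>?A\<^esub> path_elem [a]) =
      skew_zigzag_ideal V E u +>\<^bsub>?A\<^esub> path_elem [a]" if "a \<in> V" for a
  proof -
    have "path_elem [a] \<in> carrier ?A"
      using that by (intro path_algebra_single_closed) (simp add: graph_path_def)
    moreover have "skew_zigzag_ideal V E v \<subseteq> carrier ?A"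
      using ideal_skew_zigzag_ideal[OF G, of v]
      by (meson additive_subgroup.a_subset ideal.axioms(1))
    ultimately show ?thesis
      using image_coset[OF _ rescale_hom[OF V, of t E]] by (simp add: eq rescale_single)
  qed
  ultimately show ?thesis
    unfolding vertex_preserving_isomorphic_def quotient_algebra_simps path_algebra_simps by blast
qed

section \<open>Rescalings from isomorphisms\<close>

text \<open>
  Modulo the relations, every loop \<open>(a | b | a)\<close> is the multiple \<open>u a b c\<close> of the loop \<open>(a | c | a)\<close>.
  This functional is the resulting coordinate of the part of \<open>f\<close> formed by the loops of length 2
  at \<open>a\<close>; it shows that these loops do not vanish in the quotient.
\<close>
definition loop_value :: "'v set set \<Rightarrow> ('v \<Rightarrow> 'v \<Rightarrow> 'v \<Rightarrow> 'k::field) \<Rightarrow> 'v \<Rightarrow> 'v \<Rightarrow> ('v, 'k) combination \<Rightarrow> 'k" where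
  "loop_value E u a c f = (\<Sum>b | {a, b} \<in> E. coef f [a, b, a] * u a b c)"

definition short_vanishing ::
  "'v set \<Rightarrow> 'v set set \<Rightarrow> ('v \<Rightarrow> 'v \<Rightarrow> 'v \<Rightarrow> 'k::field) \<Rightarrow> ('v, 'k) combination set" where
  "short_vanishing V E u = {f \<in> carrier (path_algebra V E).
     (\<forall>a. coef f [a] = 0) \<and> (\<forall>a b. coef f [a, b] = 0) \<and>
     (\<forall>a c. {a, c} \<in> E \<longrightarrow> loop_value E u a c f = 0)}"

lemma coef_mult_short:
  assumes f: "f \<in> carrier (path_algebra V E)" and g: "g \<in> carrier (path_algebra V E)"
  shows "coef (combination_mult f g) [a] = coef f [a] * coef g [a]"
    "coef (combination_mult f g) [a, b] = coef f [a] * coef g [a, b] + coef f [a, b] * coef g [b]"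
    "coef (combination_mult f g) [a, b, c] =
       coef f [a] * coef g [a, b, c] + coef f [a, b] * coef g [b, c] + coef f [a, b, c] * coef g [c]"
  unfolding coef_mult_path_algebra[OF f g] by (simp_all add: lessThan_Suc algebra_simps)

text \<open>
  An element without terms of length 0 and 1 can only be multiplied in degree 2 by the terms of
  length 0 of the other factor.  So a product by another factor multiplies \<^const>\<open>loop_value\<close> at
  \<open>a\<close> by the coefficient of that factor at \<open>[a]\<close>.
\<close>
lemma ideal_short_vanishing:
  fixes u :: "'v \<Rightarrow> 'v \<Rightarrow> 'v \<Rightarrow> 'k::field"
  assumes G: "simple_graph V E"
  shows "ideal (short_vanishing V E u) (path_algebra V E)"
proof (rule idealI[OF simple_graph_ring_path_algebra[OF G]])
  let ?A = "path_algebra V E :: ('k, ('v, 'k) combination, 'v) graded_algebra"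
  let ?K = "short_vanishing V E u"
  have V: "finite V" using G by (simp add: simple_graph_def)
  interpret A: ring ?A by (rule simple_graph_ring_path_algebra[OF G])
  show "subgroup ?K (add_monoid ?A)"
  proof (rule group.subgroupI[OF A.a_group])
    show "?K \<noteq> {}"
      by (auto simp: short_vanishing_def loop_value_def carrier_path_algebra_iff intro!: exI[of _ 0])
    show "inv\<^bsub>add_monoid ?A\<^esub> f \<in> ?K" if "f \<in> ?K" for f
    proof -
      have "inv\<^bsub>add_monoid ?A\<^esub> f = - f"
        using a_inv_path_algebra[OF V, of f E] that by (simp add: a_inv_def short_vanishing_def)
      then show ?thesis
        using that by (simp add: short_vanishing_def loop_value_def carrier_path_algebra_iff sum_negf)
    qed
  qed (auto simp: short_vanishing_def loop_value_def path_algebra_add_closed lookup_add sum.distrib distrib_right)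
  fix f g assume f: "f \<in> ?K" and g: "g \<in> carrier ?A"
  then have f': "f \<in> carrier ?A" by (simp add: short_vanishing_def)
  have "loop_value E u a c (combination_mult g f) = coef g [a] * loop_value E u a c f"
    "loop_value E u a c (combination_mult f g) = loop_value E u a c f * coef g [a]" for a c
    using f unfolding loop_value_def sum_distrib_left sum_distrib_right
    by (simp_all add: coef_mult_short[OF g f'] coef_mult_short[OF f' g] short_vanishing_def mult_ac)
  then show "g \<otimes>\<^bsub>?A\<^esub> f \<in> ?K" "f \<otimes>\<^bsub>?A\<^esub> g \<in> ?K"
    using f g f' by (simp_all add: short_vanishing_def combination_mult_closed
        coef_mult_short[OF g f'] coef_mult_short[OF f' g])
qed

lemma loop_value_single:
  assumes "simple_graph V E" "{a, b} \<in> E"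
  shows "loop_value E u a c (Poly_Mapping.single (Path [a, b, a]) k) = k * u a b c"
proof -
  have "loop_value E u a c (Poly_Mapping.single (Path [a, b, a]) k) =
      (\<Sum>x | {a, x} \<in> E. if x = b then k * u a b c else 0)"
    unfolding loop_value_def by (intro sum.cong refl) (auto simp: lookup_single when_def)
  then show ?thesis
    using assms simple_graph_finite_neighbours[of V E a] by simp
qed

lemma loop_value_single_other:
  assumes "\<And>b. p \<noteq> [a, b, a]"
  shows "loop_value E u a c (Poly_Mapping.single (Path p) k) = 0"
  unfolding loop_value_def using assms by (intro sum.neutral) (auto simp: lookup_single when_def)

lemma loop_value_diff: "loop_value E u a c (f - g) = loop_value E u a c f - loop_value E u a c g"
  by (simp add: loop_value_def lookup_minus left_diff_distrib sum_subtractf)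

lemma SZC_cocycle:
  assumes "u \<in> SZC E" "{a, b} \<in> E" "{a, c} \<in> E" "{a, d} \<in> E"
  shows "u a b c * u a c d = u a b d" "u a b c \<noteq> 0"
proof -
  have uc: "u a b c * u a c d * u a d b = 1" and ub: "u a b d * u a d b = 1" and un: "u a b c * u a c b = 1"
    using assms unfolding SZC_def by blast+
  show "u a b c \<noteq> 0" using un by auto
  have "u a d b \<noteq> 0" using ub by auto
  then show "u a b c * u a c d = u a b d" using uc ub by (metis mult_right_cancel)
qed

text \<open>
  By the cocycle condition \<open>u a b c * u a c d = u a b d\<close>, the relation that expresses \<open>(a | b | a)\<close> by
  \<open>(a | c | a)\<close> is compatible with expressing both by \<open>(a | d | a)\<close>.
\<close>
lemma skew_zigzag_ideal_subset_short_vanishing: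
  assumes G: "simple_graph V E" and u: "u \<in> SZC E"
  shows "skew_zigzag_ideal V E u \<subseteq> short_vanishing V E u"
proof (rule ring.genideal_minimal[OF simple_graph_ring_path_algebra[OF G] ideal_short_vanishing[OF G]], rule subsetI)
  fix f assume f: "f \<in> skew_zigzag_relations E u"
  then have fc: "f \<in> carrier (path_algebra V E)" using skew_zigzag_relations_closed[OF G] by blast
  from f[unfolded skew_zigzag_relations_def] show "f \<in> short_vanishing V E u"
  proof (elim UnE CollectE exE conjE)
    fix a b c assume f: "f = path_elem [a, b, c]" "a \<noteq> c"
    have "loop_value E u x y f = 0" for x y
      unfolding f(1) using f(2) by (intro loop_value_single_other) auto
    then show ?thesis
      using fc by (auto simp: short_vanishing_def f(1) lookup_single when_def)
  next
    fix a b c assume f: "f = path_elem [a, b, a] - Poly_Mapping.single (Path [a, c, a]) (u a b c)"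
      and e: "{a, b} \<in> E" "{a, c} \<in> E"
    have "loop_value E u x y f = 0" if "{x, y} \<in> E" for x y
    proof (cases "x = a")
      case True
      then show ?thesis
        using SZC_cocycle(1)[OF u e, of y] that
        by (simp add: f loop_value_diff loop_value_single[OF G] e)
    next
      case False
      then show ?thesis
        by (simp add: f loop_value_diff loop_value_single_other)
    qed
    then show ?thesis
      using fc by (auto simp: short_vanishing_def f lookup_minus lookup_single when_def)
  qed
qed

text \<open>
  As \<open>[a] (a | b) [b] = (a | b)\<close>, the image of an edge has the same property and degree 1, so it is a
  multiple \<open>t a b\<close> of the edge.  The scalars \<open>t a b * t b a\<close> are the required rescaling, as one sees
  by mapping a relation between two loops at \<open>a\<close> and taking \<^const>\<open>loop_value\<close>.
\<close>
lemma isomorphic_imp_rescaling: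
  fixes v u :: "'v \<Rightarrow> 'v \<Rightarrow> 'v \<Rightarrow> 'k::field"
  assumes G: "simple_graph V E" and v: "v \<in> SZC E" and u: "u \<in> SZC E"
    and iso: "vertex_preserving_isomorphic V
      (quotient_algebra (path_algebra V E) (skew_zigzag_ideal V E v))
      (quotient_algebra (path_algebra V E) (skew_zigzag_ideal V E u))"
  shows "same_up_to_rescaling E v u"
proof -
  let ?A = "path_algebra V E :: ('k, ('v, 'k) combination, 'v) graded_algebra"
  let ?I = "skew_zigzag_ideal V E v" and ?J = "skew_zigzag_ideal V E u"
  let ?QI = "quotient_algebra ?A ?I" and ?QJ = "quotient_algebra ?A ?J"
  have V: "finite V" using G by (simp add: simple_graph_def)
  have I: "ideal ?I ?A" and J: "ideal ?J ?A"
    by (intro ideal_skew_zigzag_ideal G)+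
  interpret I: ideal ?I ?A by (rule I)
  interpret J: ideal ?J ?A by (rule J)
  obtain \<phi> where \<phi>: "\<phi> \<in> graded_algebra_iso ?QI ?QJ"
    and \<phi>v: "\<And>a. a \<in> V \<Longrightarrow> \<phi> (?I +>\<^bsub>?A\<^esub> path_elem [a]) = ?J +>\<^bsub>?A\<^esub> path_elem [a]"
    using iso unfolding vertex_preserving_isomorphic_def quotient_algebra_simps path_algebra_simps by blast
  note \<phi>h = graded_algebra_isoD(1)[OF \<phi>]
  have coset: "?I +>\<^bsub>?A\<^esub> x \<in> carrier ?QI" if "x \<in> carrier ?A" for x
    using that by (auto simp: quotient_algebra_simps)
  have \<phi>mult: "\<phi> (?I +>\<^bsub>?A\<^esub> combination_mult x y) = ?J +>\<^bsub>?A\<^esub> combination_mult x' y'"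
    if "\<phi> (?I +>\<^bsub>?A\<^esub> x) = ?J +>\<^bsub>?A\<^esub> x'" "\<phi> (?I +>\<^bsub>?A\<^esub> y) = ?J +>\<^bsub>?A\<^esub> y'"
      "x \<in> carrier ?A" "y \<in> carrier ?A" "x' \<in> carrier ?A" "y' \<in> carrier ?A" for x y x' y'
    using ring_hom_mult[OF \<phi>h coset[OF that(3)] coset[OF that(4)]] that
      I.rcoset_mult_add[of x y] J.rcoset_mult_add[of x' y']
    by (simp add: quotient_algebra_simps)
  have vertex: "path_elem [a] \<in> carrier ?A" if "a \<in> V" for a
    using that by (intro path_algebra_single_closed) (simp add: graph_path_def)
  have edge: "Poly_Mapping.single (Path [a, b]) k \<in> carrier ?A" if "{a, b} \<in> E" for a b k
    using simple_graph_edgeD[OF G that] that by (intro path_algebra_single_closed) (simp add: graph_path_def)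
  have loop: "Poly_Mapping.single (Path [a, b, a]) k \<in> carrier ?A" if "{a, b} \<in> E" for a b k
    using simple_graph_edgeD[OF G that] that by (intro path_algebra_single_closed) (simp add: graph_path_def)
  have "\<exists>k. \<phi> (?I +>\<^bsub>?A\<^esub> path_elem [a, b]) = ?J +>\<^bsub>?A\<^esub> Poly_Mapping.single (Path [a, b]) k"
    if e: "{a, b} \<in> E" for a b
  proof -
    note ab = simple_graph_edgeD[OF G e]
    have "path_elem [a, b] \<in> component ?A 1"
      unfolding component_path_algebra_iff using edge[OF e] by (auto simp: lookup_single when_def)
    then have "\<phi> (?I +>\<^bsub>?A\<^esub> path_elem [a, b]) \<in> component ?QJ 1"
      using graded_algebra_isoD(4)[OF \<phi>, of 1] by (auto simp: quotient_algebra_simps)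
    then obtain f where f: "f \<in> component ?A 1" and \<phi>f: "\<phi> (?I +>\<^bsub>?A\<^esub> path_elem [a, b]) = ?J +>\<^bsub>?A\<^esub> f"
      by (auto simp: quotient_algebra_simps)
    have fc: "f \<in> carrier ?A" and f1: "\<And>p. coef f p \<noteq> 0 \<Longrightarrow> length p = 2"
      using f by (auto simp: component_path_algebra_iff)
    (* Sandwiching a representative between the idempotents removes all edges but (a | b). *)
    have cut: "combination_mult (combination_mult (path_elem [a]) (path_elem [a, b])) (path_elem [b]) =
        (path_elem [a, b] :: ('v, 'k) combination)"
      by (simp add: combination_mult_single)
    have "combination_mult (combination_mult (path_elem [a]) f) (path_elem [b]) =
        Poly_Mapping.single (Path [a, b]) (coef f [a, b])" (is "?l = ?r")
    proof (rule path_algebra_eqI[of _ V E])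
      fix p
      have "coef ?l p = (if last p = b \<and> hd p = a then coef f p else 0)"
        using coef_mult_vertex[OF combination_mult_closed[OF vertex[OF ab(1)] fc] ab(2)]
          coef_vertex_mult[OF fc ab(1)] by simp
      also have "\<dots> = coef ?r p"
        using f1[of p] by (cases "coef f p = 0") (auto simp: lookup_single when_def length_Suc_conv numeral_2_eq_2)
      finally show "coef ?l p = coef ?r p" .
    qed (intro combination_mult_closed vertex fc ab edge e)+
    then have "\<phi> (?I +>\<^bsub>?A\<^esub> path_elem [a, b]) = ?J +>\<^bsub>?A\<^esub> ?r"
      using \<phi>mult[OF \<phi>mult[OF \<phi>v[OF ab(1)] \<phi>f] \<phi>v[OF ab(2)]] vertex[OF ab(1)] vertex[OF ab(2)] edge[OF e] fc
      by (simp add: cut combination_mult_closed)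
    then show ?thesis by blast
  qed
  then obtain t where t: "\<And>a b. {a, b} \<in> E \<Longrightarrow>
      \<phi> (?I +>\<^bsub>?A\<^esub> path_elem [a, b]) = ?J +>\<^bsub>?A\<^esub> Poly_Mapping.single (Path [a, b]) (t a b)"
    by metis
  (* A zero scalar would put the edge into the kernel, but edges are not in the ideal. *)
  have t0: "t a b \<noteq> 0" if e: "{a, b} \<in> E" for a b
  proof
    assume "t a b = 0"
    then have "\<phi> (?I +>\<^bsub>?A\<^esub> path_elem [a, b]) = ?J +>\<^bsub>?A\<^esub> 0"
      using t[OF e] by simp
    also have "\<dots> = \<phi> (?I +>\<^bsub>?A\<^esub> 0)"
    proof -
      have 0: "0 \<in> carrier ?A" by (simp add: carrier_path_algebra_iff)
      have "\<phi> (0 \<odot>\<^bsub>?QI\<^esub> (?I +>\<^bsub>?A\<^esub> 0)) = 0 \<odot>\<^bsub>?QJ\<^esub> \<phi> (?I +>\<^bsub>?A\<^esub> 0)"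
        by (rule graded_algebra_isoD(3)[OF \<phi> coset[OF 0]])
      moreover have "\<phi> (?I +>\<^bsub>?A\<^esub> 0) \<in> carrier ?QJ"
        by (rule ring_hom_closed[OF \<phi>h coset[OF 0]])
      then obtain y where "y \<in> carrier ?A" "\<phi> (?I +>\<^bsub>?A\<^esub> 0) = ?J +>\<^bsub>?A\<^esub> y"
        by (auto simp: quotient_algebra_simps)
      moreover have "Poly_Mapping.map (\<lambda>z. 0 * z) x = 0" for x :: "('v, 'k) combination"
        by (rule poly_mapping_eqI) (subst lookup_scale, simp)
      ultimately show ?thesis
        by (simp only: smult_coset[OF V I 0] smult_coset[OF V J])
    qed
    finally have "?I +>\<^bsub>?A\<^esub> path_elem [a, b] = ?I +>\<^bsub>?A\<^esub> 0"
      using graded_algebra_isoD(2)[OF \<phi>] coset edge[OF e] by (metis I.zero_closed bij_betw_def inj_onD path_algebra_simps(3))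
    then have "path_elem [a, b] \<in> ?I"
      using path_algebra_coset_eq_iff[OF V I edge[OF e, of 1], of 0] I.zero_closed by simp
    then show False
      using skew_zigzag_ideal_subset_short_vanishing[OF G v] by (force simp: short_vanishing_def)
  qed
  have \<phi>loop: "\<phi> (?I +>\<^bsub>?A\<^esub> path_elem [a, b, a]) =
      ?J +>\<^bsub>?A\<^esub> Poly_Mapping.single (Path [a, b, a]) (t a b * t b a)" if e: "{a, b} \<in> E" for a b
  proof -
    note ba = simple_graph_edgeD(4)[OF G e]
    show ?thesis
      using \<phi>mult[OF t[OF e] t[OF ba] edge[OF e] edge[OF ba] edge[OF e] edge[OF ba]]
      by (simp add: combination_mult_single)
  qed
  have "u a b c * (t a b * t b a) = v a b c * (t a c * t c a)" if e: "{a, b} \<in> E" "{a, c} \<in> E" for a b c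
  proof -
    let ?x = "Poly_Mapping.single (Path [a, c, a]) (v a b c)"
    let ?y = "Poly_Mapping.single (Path [a, b, a]) (t a b * t b a)"
    let ?z = "Poly_Mapping.single (Path [a, c, a]) (v a b c * (t a c * t c a))"
    have "path_elem [a, b, a] - ?x \<in> ?I"
      using e I.genideal_self[OF skew_zigzag_relations_closed[OF G], of v] by (force simp: skew_zigzag_relations_def)
    then have "?I +>\<^bsub>?A\<^esub> path_elem [a, b, a] = ?I +>\<^bsub>?A\<^esub> ?x"
      using path_algebra_coset_eq_iff[OF V I loop[OF e(1)] loop[OF e(2)]] by simp
    also have "\<dots> = v a b c \<odot>\<^bsub>?QI\<^esub> (?I +>\<^bsub>?A\<^esub> path_elem [a, c, a])"
      unfolding smult_coset[OF V I loop[OF e(2)]]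
      by (rule arg_cong[of _ _ "\<lambda>x. ?I +>\<^bsub>?A\<^esub> x"], rule poly_mapping_eqI)
        (simp add: lookup_scale lookup_single when_def)
    finally have "\<phi> (?I +>\<^bsub>?A\<^esub> path_elem [a, b, a]) = v a b c \<odot>\<^bsub>?QJ\<^esub> \<phi> (?I +>\<^bsub>?A\<^esub> path_elem [a, c, a])"
      using graded_algebra_isoD(3)[OF \<phi> coset[OF loop[OF e(2)]]] by simp
    also have "\<dots> = ?J +>\<^bsub>?A\<^esub> ?z"
      unfolding \<phi>loop[OF e(2)] smult_coset[OF V J loop[OF e(2)]]
      by (rule arg_cong[of _ _ "\<lambda>x. ?J +>\<^bsub>?A\<^esub> x"], rule poly_mapping_eqI)
        (simp add: lookup_scale lookup_single when_def)
    finally have "?J +>\<^bsub>?A\<^esub> ?y = ?J +>\<^bsub>?A\<^esub> ?z"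
      unfolding \<phi>loop[OF e(1)] .
    then have "?y - ?z \<in> ?J"
      using path_algebra_coset_eq_iff[OF V J loop[OF e(1)] loop[OF e(2)]] by simp
    then have "loop_value E u a c (?y - ?z) = 0"
      using skew_zigzag_ideal_subset_short_vanishing[OF G u] e by (auto simp: short_vanishing_def)
    moreover have "u a c c = 1"
      using u e unfolding SZC_def by blast
    ultimately show ?thesis
      by (simp add: loop_value_diff loop_value_single[OF G] e mult.commute)
  qed
  then show ?thesis
    unfolding same_up_to_rescaling_def using t0 simple_graph_edgeD(4)[OF G]
    by (intro exI[of _ "\<lambda>a b. t a b * t b a"]) (auto simp: mult.commute)
qed

section \<open>The equivalence relation on coefficients\<close>

text \<open>
  With at most two vertices every vertex has at most one neighbour, so the special definitions of
  \<open>A\<^sub>v\<close> for these graphs concern a single collection of coefficients.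
\<close>
lemma SZC_small_trivial:
  assumes G: "simple_graph V E" and V: "card V \<le> 2" and v: "v \<in> SZC E"
  shows "v = (\<lambda>a b c. 1)"
proof (intro ext)
  fix a b c
  show "v a b c = 1"
  proof (cases "{a, b} \<in> E \<and> {a, c} \<in> E")
    case True
    then have abc: "{a, b, c} \<subseteq> V" "a \<noteq> b" "a \<noteq> c"
      using simple_graph_edgeD[OF G] by (metis empty_subsetI insert_subset)+
    have "b = c"
    proof (rule ccontr)
      assume "b \<noteq> c"
      then have "card {a, b, c} = 3" using abc by simp
      then show False
        using card_mono[of V "{a, b, c}"] abc V G by (simp add: simple_graph_def)
    qed
    then show ?thesis using True v unfolding SZC_def by blast
  next
    case False
    then show ?thesis using v unfolding SZC_def by blast
  qed
qed

lemma SZC_rel_iff: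
  fixes v u :: "'v \<Rightarrow> 'v \<Rightarrow> 'v \<Rightarrow> 'k::field"
  assumes sqrt: "\<forall>x::'k. \<exists>y. y ^ 2 = x" and G: "simple_graph V E"
  shows "(v, u) \<in> SZC_rel V E \<longleftrightarrow> v \<in> SZC E \<and> u \<in> SZC E \<and> same_up_to_rescaling E v u"
proof (cases "card V \<le> 2")
  case True
  have "same_up_to_rescaling E v v"
    unfolding same_up_to_rescaling_def by (intro exI[of _ "\<lambda>a b. 1"]) auto
  then show ?thesis
    using SZC_small_trivial[OF G True, of v] SZC_small_trivial[OF G True, of u]
    by (auto simp: SZC_rel_def vertex_preserving_isomorphic_refl)
next
  case False
  then show ?thesis
    using rescaling_imp_isomorphic[OF sqrt G, of v u] isomorphic_imp_rescaling[OF G, of v u]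
    by (auto simp: SZC_rel_def skew_zigzag_algebra_def)
qed

section \<open>Chains and cycles\<close>

abbreviation edge_chains :: "'v set set \<Rightarrow> ('v \<times> 'v \<Rightarrow>\<^sub>0 int) monoid" where
  "edge_chains E \<equiv> free_Abelian_group (directed_edges E)"

text \<open>
  In the chain group, a chain is taken modulo this subgroup, so that reversing an edge changes its
  sign.
\<close>
definition flips :: "'v set set \<Rightarrow> ('v \<times> 'v \<Rightarrow>\<^sub>0 int) set" where
  "flips E = generate (edge_chains E) {frag_of (a, b) + frag_of (b, a) | a b. {a, b} \<in> E}"

definition chain_boundary :: "('v \<times> 'v \<Rightarrow>\<^sub>0 int) \<Rightarrow> ('v \<Rightarrow>\<^sub>0 int)" where
  "chain_boundary = frag_extend (\<lambda>(a, b). frag_of a - frag_of b)"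

definition chain_class :: "'v set set \<Rightarrow> ('v \<times> 'v \<Rightarrow>\<^sub>0 int) \<Rightarrow> ('v \<times> 'v \<Rightarrow>\<^sub>0 int) set" where
  "chain_class E x = flips E #>\<^bsub>edge_chains E\<^esub> x"

lemma directed_edges_iff [simp]: "(a, b) \<in> directed_edges E \<longleftrightarrow> {a, b} \<in> E"
  by (simp add: directed_edges_def)

lemma finite_directed_edges:
  assumes "simple_graph V E"
  shows "finite (directed_edges E)"
  by (rule finite_subset[of _ "V \<times> V"])
    (use assms simple_graph_edgeD(1,2)[OF assms] in \<open>auto simp: simple_graph_def directed_edges_def\<close>)

lemma flip_generators: "{frag_of (a, b) + frag_of (b, a) | a b. {a, b} \<in> E} \<subseteq> carrier (edge_chains E)"
proof -
  have "Poly_Mapping.keys (frag_of (a, b) + frag_of (b, a)) \<subseteq> directed_edges E" if "{a, b} \<in> E" for a b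
    using keys_add[of "frag_of (a, b)" "frag_of (b, a)"] that by (auto simp: insert_commute)
  then show ?thesis by auto
qed

lemma subgroup_flips: "subgroup (flips E) (edge_chains E)"
  unfolding flips_def by (intro group.generate_is_subgroup group_free_Abelian_group flip_generators)

lemma normal_flips: "flips E \<lhd> edge_chains E"
  by (intro comm_group.subgroup_imp_normal abelian_free_Abelian_group subgroup_flips)

lemma flips_closed: "n \<in> flips E \<Longrightarrow> n \<in> carrier (edge_chains E)"
  using subgroup.subset[OF subgroup_flips] by blast

lemma chain_class_eq: "chain_class E x = (\<lambda>n. n + x) ` flips E"
  by (auto simp: chain_class_def r_coset_def)

lemma chain_class_eqI:
  assumes "x \<in> carrier (edge_chains E)" "y - x \<in> flips E"
  shows "chain_class E y = chain_class E x"
proof -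
  have "y \<in> chain_class E x"
    unfolding chain_class_eq using assms(2) by (metis diff_add_cancel image_eqI)
  then show ?thesis
    unfolding chain_class_def
    using group.repr_independence[OF group_free_Abelian_group _ assms(1) subgroup_flips] by metis
qed

lemma carrier_chain_group: "carrier (chain_group E) = chain_class E ` carrier (edge_chains E)"
  unfolding chain_group_def flips_def[symmetric] by (auto simp: FactGroup_def RCOSETS_def chain_class_def)

lemma mult_chain_class:
  assumes "x \<in> carrier (edge_chains E)" "y \<in> carrier (edge_chains E)"
  shows "chain_class E x \<otimes>\<^bsub>chain_group E\<^esub> chain_class E y = chain_class E (x + y)"
  unfolding chain_group_def flips_def[symmetric] chain_class_def
  using normal.rcos_sum[OF normal_flips assms] by (simp add: FactGroup_def)

lemma chain_boundary_simps [simp]: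
  "chain_boundary 0 = 0"
  "chain_boundary (x + y) = chain_boundary x + chain_boundary y"
  "chain_boundary (x - y) = chain_boundary x - chain_boundary y"
  "chain_boundary (- x) = - chain_boundary x"
  "chain_boundary (frag_of (a, b)) = frag_of a - frag_of b"
  by (simp_all add: chain_boundary_def frag_extend_add frag_extend_diff frag_extend_minus)

lemma flips_induct [consumes 1, case_names zero flip minus add]:
  assumes "n \<in> flips E" "P 0"
    and "\<And>a b. {a, b} \<in> E \<Longrightarrow> P (frag_of (a, b) + frag_of (b, a))"
    and "\<And>x. x \<in> carrier (edge_chains E) \<Longrightarrow> P x \<Longrightarrow> P (- x)"
    and "\<And>x y. x \<in> carrier (edge_chains E) \<Longrightarrow> y \<in> carrier (edge_chains E) \<Longrightarrow> P x \<Longrightarrow> P y \<Longrightarrow> P (x + y)"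
  shows "P n"
  using assms(1) unfolding flips_def
proof (induction rule: generate.induct)
  case one
  then show ?case using assms(2) by simp
next
  case (incl h)
  then show ?case using assms(3) by blast
next
  case (inv h)
  then obtain a b where "h = frag_of (a, b) + frag_of (b, a)" "{a, b} \<in> E" by blast
  moreover have hc: "h \<in> carrier (edge_chains E)" using flip_generators inv.hyps by (rule subsetD)
  ultimately have "P (- h)" using assms(3)[of a b] assms(4)[of h] by blast
  then show ?case using hc by simp
next
  case (eng h1 h2)
  then show ?case
    using assms(5)[of h1 h2] flips_closed[of h1 E] flips_closed[of h2 E]
    unfolding flips_def mult_free_Abelian_group by blast
qed

lemma chain_boundary_flips: "n \<in> flips E \<Longrightarrow> chain_boundary n = 0"
  by (induction rule: flips_induct) simp_all

lemma flips_zero: "0 \<in> flips E"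
  using subgroup.one_closed[OF subgroup_flips] by simp

text \<open>
  The boundary kills the flips, so it is constant on cosets; from here on, computations with
  \<^const>\<open>cycle_space\<close> are computations with representatives.
\<close>
lemma boundary_chain_class: "boundary (chain_class E x) = chain_boundary x"
proof -
  have "chain_boundary ` chain_class E x = {chain_boundary x}"
    unfolding chain_class_eq image_image using flips_zero[of E] by (auto simp: chain_boundary_flips)
  then show ?thesis by (simp add: boundary_def chain_boundary_def)
qed

abbreviation cycles :: "'v set set \<Rightarrow> ('v \<times> 'v \<Rightarrow>\<^sub>0 int) set" where
  "cycles E \<equiv> {x \<in> carrier (edge_chains E). chain_boundary x = 0}"

lemma carrier_cycle_space: "carrier (cycle_space V E) = chain_class E ` cycles E"
  by (auto simp: cycle_space_def kernel_def carrier_chain_group boundary_chain_class)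

lemma mult_cycle_space:
  assumes "x \<in> carrier (edge_chains E)" "y \<in> carrier (edge_chains E)"
  shows "chain_class E x \<otimes>\<^bsub>cycle_space V E\<^esub> chain_class E y = chain_class E (x + y)"
  using mult_chain_class[OF assms] by (simp add: cycle_space_def)

lemma edge_chains_add: "x \<in> carrier (edge_chains E) \<Longrightarrow> y \<in> carrier (edge_chains E) \<Longrightarrow> x + y \<in> carrier (edge_chains E)"
  using keys_add[of x y] by auto

lemma edge_chains_diff: "x \<in> carrier (edge_chains E) \<Longrightarrow> y \<in> carrier (edge_chains E) \<Longrightarrow> x - y \<in> carrier (edge_chains E)"
  using keys_diff[of x y] by auto

section \<open>Characters of the chain group\<close>

lemma unit_group_simps [simp]:
  "x \<in> carrier unit_group \<longleftrightarrow> x \<noteq> 0" "x \<otimes>\<^bsub>unit_group\<^esub> y = x * y" "\<one>\<^bsub>unit_group\<^esub> = 1"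
  by (simp_all add: unit_group_def)

lemma group_unit_group: "group (unit_group :: 'k::field monoid)"
proof (rule groupI)
  show "\<exists>y\<in>carrier unit_group. y \<otimes>\<^bsub>unit_group\<^esub> x = \<one>\<^bsub>unit_group\<^esub>"
    if "x \<in> carrier unit_group" for x :: 'k
    using that by (intro bexI[of _ "inverse x"]) auto
qed (auto simp: mult.assoc)

lemma character_simps:
  assumes g: "g \<in> hom (free_Abelian_group S) (unit_group :: 'k::field monoid)"
    and x: "Poly_Mapping.keys x \<subseteq> S"
  shows "g x \<noteq> 0" "g 0 = 1" "g (- x) = inverse (g x)"
    and "\<And>y. Poly_Mapping.keys y \<subseteq> S \<Longrightarrow> g (x + y) = g x * g y"
    and "\<And>y. Poly_Mapping.keys y \<subseteq> S \<Longrightarrow> g (x - y) = g x / g y"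
proof -
  interpret group_hom "free_Abelian_group S" "unit_group :: 'k monoid" g
    by (intro group_hom.intro group_hom_axioms.intro group_free_Abelian_group group_unit_group g)
  show nz: "g x \<noteq> 0" using hom_closed[of x] x by simp
  show "g 0 = 1" using hom_one by simp
  have add: "g (x + y) = g x * g y" if "Poly_Mapping.keys x \<subseteq> S" "Poly_Mapping.keys y \<subseteq> S" for x y
    using hom_mult[of x y] that by simp
  have neg: "g (- y) = inverse (g y)" if y: "Poly_Mapping.keys y \<subseteq> S" for y
  proof -
    have "g (- y) * g y = 1" using add[of "- y" y] y \<open>g 0 = 1\<close> by simp
    then show ?thesis by (metis inverse_unique mult.commute)
  qed
  then show "g (- x) = inverse (g x)" using x by blast
  show "g (x + y) = g x * g y" if "Poly_Mapping.keys y \<subseteq> S" for y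
    using add x that by blast
  show "g (x - y) = g x / g y" if "Poly_Mapping.keys y \<subseteq> S" for y
    using add[of x "- y"] neg[of y] x that by (simp add: divide_inverse)
qed

lemma character_eqI:
  fixes g h :: "('a \<Rightarrow>\<^sub>0 int) \<Rightarrow> 'k::field"
  assumes g: "g \<in> hom (free_Abelian_group S) unit_group" and h: "h \<in> hom (free_Abelian_group S) unit_group"
    and eq: "\<And>a. a \<in> S \<Longrightarrow> g (frag_of a) = h (frag_of a)" and x: "Poly_Mapping.keys x \<subseteq> S"
  shows "g x = h x"
  using x
proof (induction x rule: free_Abelian_group_induct[consumes 1, case_names zero diff generator])
  case zero
  then show ?case using character_simps(2)[OF g, of 0] character_simps(2)[OF h, of 0] by simp
next
  case (diff x y)
  then show ?case by (simp add: character_simps(5)[OF g] character_simps(5)[OF h])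
qed (use eq in simp)

text \<open>
  A character that takes inverse values on an edge and its reverse descends to the chain group.
\<close>
lemma character_flips:
  fixes g :: "('v \<times> 'v \<Rightarrow>\<^sub>0 int) \<Rightarrow> 'k::field"
  assumes g: "g \<in> hom (edge_chains E) unit_group"
    and "\<And>a b. {a, b} \<in> E \<Longrightarrow> g (frag_of (a, b)) * g (frag_of (b, a)) = 1"
    and "n \<in> flips E"
  shows "g n = 1"
  using assms(3)
proof (induction rule: flips_induct)
  case zero
  then show ?case using character_simps(2)[OF g, of 0] by simp
next
  case (flip a b)
  then show ?case
    using assms(2)[OF flip] by (subst character_simps(4)[OF g]) (simp_all add: insert_commute)
qed (simp_all add: character_simps[OF g])

text \<open>
  This is the character of the free abelian group on a finite set \<open>S\<close> that extends \<open>\<theta>\<close>.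
\<close>
definition evaluation :: "'a set \<Rightarrow> ('a \<Rightarrow> 'k::field) \<Rightarrow> ('a \<Rightarrow>\<^sub>0 int) \<Rightarrow> 'k" where
  "evaluation S \<theta> x = (\<Prod>e\<in>S. \<theta> e powi Poly_Mapping.lookup x e)"

lemma evaluation_hom:
  assumes "finite S" "\<And>e. e \<in> S \<Longrightarrow> \<theta> e \<noteq> 0"
  shows "evaluation S \<theta> \<in> hom (free_Abelian_group S) unit_group"
  using assms
  by (intro homI) (auto simp: evaluation_def lookup_add power_int_add prod.distrib)

lemma evaluation_frag_of:
  assumes "finite S" "e \<in> S"
  shows "evaluation S \<theta> (frag_of e) = \<theta> e"
proof -
  have "evaluation S \<theta> (frag_of e) = (\<Prod>x\<in>S. if x = e then \<theta> e else 1)"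
    unfolding evaluation_def by (intro prod.cong) auto
  then show ?thesis using assms by simp
qed

lemma evaluation_mult:
  "evaluation S (\<lambda>e. \<theta> e * \<eta> e) x = evaluation S \<theta> x * evaluation S \<eta> x"
  by (simp add: evaluation_def power_int_mult_distrib prod.distrib)

lemma keys_chain_boundary:
  assumes "simple_graph V E" "x \<in> carrier (edge_chains E)"
  shows "Poly_Mapping.keys (chain_boundary x) \<subseteq> V"
proof -
  have "Poly_Mapping.keys (frag_of a - frag_of b) \<subseteq> V" if "{a, b} \<in> E" for a b :: 'a
    using keys_diff[of "frag_of a" "frag_of b"] simple_graph_edgeD(1,2)[OF assms(1) that] by auto
  then show ?thesis
    using assms(2) keys_frag_extend[of "\<lambda>(a, b). frag_of a - frag_of b" x]
    unfolding chain_boundary_def by fastforce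
qed

text \<open>
  The character given by \<open>f a / f b\<close> on edges factors through the boundary: it is the boundary
  followed by the extension of \<open>f\<close> to the free abelian group on the vertices.
\<close>
lemma evaluation_coboundary:
  fixes f :: "'v \<Rightarrow> 'k::field"
  assumes G: "simple_graph V E" and f: "\<And>a. a \<in> V \<Longrightarrow> f a \<noteq> 0" and x: "x \<in> cycles E"
  shows "evaluation (directed_edges E) (\<lambda>(a, b). f a / f b) x = 1"
proof -
  have V: "finite V" using G by (simp add: simple_graph_def)
  let ?g = "\<lambda>x. evaluation V f (chain_boundary x)"
  have fhom: "evaluation V f \<in> hom (free_Abelian_group V) unit_group"
    by (rule evaluation_hom[OF V f])
  have 1: "?g \<in> hom (edge_chains E) unit_group"
    using keys_chain_boundary[OF G] character_simps(1,4)[OF fhom]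
    by (intro homI) auto
  have 2: "evaluation (directed_edges E) (\<lambda>(a, b). f a / f b) \<in> hom (edge_chains E) unit_group"
    using f simple_graph_edgeD(1,2)[OF G] by (intro evaluation_hom[OF finite_directed_edges[OF G]]) auto
  have "evaluation (directed_edges E) (\<lambda>(a, b). f a / f b) x = ?g x"
  proof (rule character_eqI[OF 2 1])
    fix e assume e: "e \<in> directed_edges E"
    obtain a b where ab: "e = (a, b)" by (cases e)
    have "evaluation V f (frag_of a - frag_of b) = f a / f b"
      using e ab simple_graph_edgeD(1,2)[OF G, of a b]
      by (subst character_simps(5)[OF fhom]) (simp_all add: evaluation_frag_of[OF V])
    then show "evaluation (directed_edges E) (\<lambda>(a, b). f a / f b) (frag_of e) = ?g (frag_of e)"
      using evaluation_frag_of[OF finite_directed_edges[OF G] e, of "\<lambda>(a, b). f a / f b"] ab by simp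
  qed (use x in simp)
  also have "\<dots> = 1"
    using x character_simps(2)[OF fhom, of 0] by simp
  finally show ?thesis .
qed

section \<open>Paths from a base vertex\<close>

text \<open>
  The sum of the edges of a path has the ends of the path as its boundary.
\<close>
lemma path_chain:
  assumes "graph_path V E p"
  shows "\<exists>x \<in> carrier (edge_chains E). chain_boundary x = frag_of (hd p) - frag_of (last p)"
  using assms
proof (induction p rule: induct_list012)
  case (2 a)
  then show ?case by (intro bexI[of _ 0]) simp_all
next
  case (3 a b p)
  then obtain x where x: "x \<in> carrier (edge_chains E)" "chain_boundary x = frag_of b - frag_of (last (b # p))"
    by (auto simp: graph_path_def)
  have "frag_of (a, b) \<in> carrier (edge_chains E)"
    using 3 by (simp add: graph_path_def)
  then show ?case
    using x by (intro bexI[of _ "frag_of (a, b) + x"] edge_chains_add) simp_all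
qed (simp add: graph_path_def)

lemma base_vertex_chains:
  assumes "connected_graph V E"
  obtains r P where "\<And>a. a \<in> V \<Longrightarrow> P a \<in> carrier (edge_chains E)"
    and "\<And>a. a \<in> V \<Longrightarrow> chain_boundary (P a) = frag_of r - frag_of a"
proof -
  obtain r where r: "r \<in> V"
    using assms by (auto simp: connected_graph_def)
  have "\<exists>x. x \<in> carrier (edge_chains E) \<and> chain_boundary x = frag_of r - frag_of a" if "a \<in> V" for a
    using assms path_chain[of V E] r that unfolding connected_graph_def by metis
  then show thesis
    using that[of _ r] by metis
qed

section \<open>The coefficient group and the cohomology group\<close>

lemma SZC_group_simps [simp]:
  "carrier (SZC_group E) = SZC E" "u \<otimes>\<^bsub>SZC_group E\<^esub> v = (\<lambda>a b c. u a b c * v a b c)"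
  "\<one>\<^bsub>SZC_group E\<^esub> = (\<lambda>a b c. 1)"
  by (simp_all add: SZC_group_def)

lemma SZC_nonzero: "v \<in> SZC E \<Longrightarrow> v a b c \<noteq> 0"
  using SZC_cocycle(2)[of v E a b c b] unfolding SZC_def by (cases "{a, b} \<in> E \<and> {a, c} \<in> E") auto

lemma SZC_mult:
  assumes u: "u \<in> SZC E" and v: "v \<in> SZC E"
  shows "(\<lambda>a b c. u a b c * v a b c) \<in> SZC E"
proof -
  have mid: "(x * y) * (z * w) = (x * z) * (y * w)" for x y z w :: 'b
    by (simp add: mult_ac)
  show ?thesis
    using u v unfolding SZC_def mem_Collect_eq mid by (metis mult_1)
qed

lemma SZC_inverse:
  assumes "v \<in> SZC E"
  shows "(\<lambda>a b c. inverse (v a b c)) \<in> SZC E"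
proof -
  have "inverse x * inverse y = inverse (x * y)" for x y :: 'b
    by simp
  then show ?thesis
    using assms unfolding SZC_def mem_Collect_eq by (metis inverse_1)
qed

lemma group_SZC_group: "group (SZC_group E)"
proof (rule groupI)
  show "\<exists>y\<in>carrier (SZC_group E). y \<otimes>\<^bsub>SZC_group E\<^esub> x = \<one>\<^bsub>SZC_group E\<^esub>"
    if "x \<in> carrier (SZC_group E)" for x
    using that SZC_nonzero[of x E] by (intro bexI[of _ "\<lambda>a b c. inverse (x a b c)"]) (auto simp: SZC_inverse)
  show "\<one>\<^bsub>SZC_group E\<^esub> \<in> carrier (SZC_group E)"
    by (simp add: SZC_def)
qed (simp_all add: SZC_mult mult.assoc)

lemma graph_cohomology_simps [simp]:
  "carrier (graph_cohomology V E) = hom (cycle_space V E) unit_group \<inter> extensional (carrier (cycle_space V E))"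
  "f \<otimes>\<^bsub>graph_cohomology V E\<^esub> g = (\<lambda>x\<in>carrier (cycle_space V E). f x * g x)"
  "\<one>\<^bsub>graph_cohomology V E\<^esub> = (\<lambda>x\<in>carrier (cycle_space V E). 1)"
  by (simp_all add: graph_cohomology_def)

lemma cycle_space_closed:
  assumes "X \<in> carrier (cycle_space V E)" "Y \<in> carrier (cycle_space V E)"
  shows "X \<otimes>\<^bsub>cycle_space V E\<^esub> Y \<in> carrier (cycle_space V E)"
proof -
  obtain x y where x: "x \<in> cycles E" "X = chain_class E x" and y: "y \<in> cycles E" "Y = chain_class E y"
    using assms by (auto simp: carrier_cycle_space)
  have "x + y \<in> cycles E"
    using x(1) y(1) edge_chains_add[of x E y] by simp
  then show ?thesis
    unfolding carrier_cycle_space x(2) y(2) using x(1) y(1) by (subst mult_cycle_space) auto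
qed

lemma group_graph_cohomology: "group (graph_cohomology V E :: (('v \<times> 'v \<Rightarrow>\<^sub>0 int) set \<Rightarrow> 'k::field) monoid)"
proof (rule groupI)
  let ?H = "graph_cohomology V E :: (('v \<times> 'v \<Rightarrow>\<^sub>0 int) set \<Rightarrow> 'k) monoid"
  let ?C = "carrier (cycle_space V E)"
  show "f \<otimes>\<^bsub>?H\<^esub> g \<in> carrier ?H" if "f \<in> carrier ?H" "g \<in> carrier ?H" for f g
    using that cycle_space_closed[of _ V E] by (auto simp: hom_def Pi_iff)
  show "\<one>\<^bsub>?H\<^esub> \<in> carrier ?H"
    using cycle_space_closed[of _ V E] by (auto simp: hom_def Pi_iff)
  show "\<one>\<^bsub>?H\<^esub> \<otimes>\<^bsub>?H\<^esub> f = f" if "f \<in> carrier ?H" for f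
    using that by (auto simp: extensional_def fun_eq_iff)
  show "\<exists>g\<in>carrier ?H. g \<otimes>\<^bsub>?H\<^esub> f = \<one>\<^bsub>?H\<^esub>" if "f \<in> carrier ?H" for f
    using that cycle_space_closed[of _ V E]
    by (intro bexI[of _ "\<lambda>x\<in>?C. inverse (f x)"]) (auto simp: hom_def fun_eq_iff Pi_iff)
qed (auto simp: mult.assoc)

section \<open>From coefficients to cohomology classes\<close>

text \<open>
  The function \<open>l\<close> with \<open>v a b c = l a b / l a c\<close> is normalized by \<open>l a c = 1\<close> at one neighbour \<open>c\<close>
  of each vertex \<open>a\<close>.  The chosen neighbour does not depend on \<open>v\<close>, so \<open>l\<close>, and hence the ratio
  \<open>l a b / l b a\<close> defined here, is multiplicative in \<open>v\<close>.
\<close>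
definition edge_ratio :: "'v set set \<Rightarrow> ('v \<Rightarrow> 'v \<Rightarrow> 'v \<Rightarrow> 'k::field) \<Rightarrow> 'v \<times> 'v \<Rightarrow> 'k" where
  "edge_ratio E v = (\<lambda>(a, b). v a b (SOME c. {a, c} \<in> E) / v b a (SOME c. {b, c} \<in> E))"

definition cohomology_map ::
  "'v set \<Rightarrow> 'v set set \<Rightarrow> ('v \<Rightarrow> 'v \<Rightarrow> 'v \<Rightarrow> 'k::field) \<Rightarrow> ('v \<times> 'v \<Rightarrow>\<^sub>0 int) set \<Rightarrow> 'k" where
  "cohomology_map V E v = (\<lambda>X\<in>carrier (cycle_space V E).
     the_elem (evaluation (directed_edges E) (edge_ratio E v) ` X))"

lemma evaluation_edge_ratio:
  assumes "simple_graph V E" "v \<in> SZC E"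
  shows "evaluation (directed_edges E) (edge_ratio E v) \<in> hom (edge_chains E) unit_group"
  by (rule evaluation_hom[OF finite_directed_edges[OF assms(1)]])
    (auto simp: edge_ratio_def SZC_nonzero[OF assms(2)])

lemma cohomology_map_chain_class:
  assumes G: "simple_graph V E" and v: "v \<in> SZC E" and x: "x \<in> cycles E"
  shows "cohomology_map V E v (chain_class E x) = evaluation (directed_edges E) (edge_ratio E v) x"
proof -
  let ?g = "evaluation (directed_edges E) (edge_ratio E v)"
  note g = evaluation_edge_ratio[OF G v]
  have "?g n = 1" if "n \<in> flips E" for n
  proof (rule character_flips[OF g _ that])
    fix a b assume "{a, b} \<in> E"
    then show "?g (frag_of (a, b)) * ?g (frag_of (b, a)) = 1"
      using SZC_nonzero[OF v]
      by (simp add: evaluation_frag_of finite_directed_edges[OF G] simple_graph_edgeD(4)[OF G] edge_ratio_def)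
  qed
  then have "?g (n + x) = ?g x" if "n \<in> flips E" for n
    using that x flips_closed[OF that] by (simp add: character_simps(4)[OF g])
  then have "?g ` chain_class E x = {?g x}"
    unfolding chain_class_eq image_image using flips_zero by auto
  moreover have "chain_class E x \<in> carrier (cycle_space V E)"
    unfolding carrier_cycle_space using x by (rule imageI)
  ultimately show ?thesis
    by (simp add: cohomology_map_def)
qed

lemma cohomology_map_closed:
  assumes G: "simple_graph V E" and v: "v \<in> SZC E"
  shows "cohomology_map V E v \<in> carrier (graph_cohomology V E)"
proof -
  note g = evaluation_edge_ratio[OF G v]
  have "cohomology_map V E v \<in> hom (cycle_space V E) unit_group"
  proof (rule homI)
    fix X assume "X \<in> carrier (cycle_space V E)"
    then obtain x where x: "x \<in> cycles E" "X = chain_class E x" by (auto simp: carrier_cycle_space)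
    then show "cohomology_map V E v X \<in> carrier unit_group"
      by (simp add: cohomology_map_chain_class[OF G v] character_simps(1)[OF g])
  next
    fix X Y assume "X \<in> carrier (cycle_space V E)" "Y \<in> carrier (cycle_space V E)"
    then obtain x y where x: "x \<in> cycles E" "X = chain_class E x" and y: "y \<in> cycles E" "Y = chain_class E y"
      by (auto simp: carrier_cycle_space)
    have xy: "x + y \<in> cycles E"
      using x(1) y(1) edge_chains_add[of x E y] by simp
    have "X \<otimes>\<^bsub>cycle_space V E\<^esub> Y = chain_class E (x + y)"
      unfolding x(2) y(2) using x(1) y(1) by (intro mult_cycle_space) auto
    then show "cohomology_map V E v (X \<otimes>\<^bsub>cycle_space V E\<^esub> Y) =
        cohomology_map V E v X \<otimes>\<^bsub>unit_group\<^esub> cohomology_map V E v Y"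
      using xy x y by (simp add: cohomology_map_chain_class[OF G v] character_simps(4)[OF g])
  qed
  then show ?thesis by (simp add: cohomology_map_def)
qed

lemma cycle_space_extensionalityI:
  assumes "\<And>x. x \<in> cycles E \<Longrightarrow> f (chain_class E x) = g (chain_class E x)"
    and "f \<in> extensional (carrier (cycle_space V E))" "g \<in> extensional (carrier (cycle_space V E))"
  shows "f = g"
proof (rule extensionalityI[OF assms(2,3)])
  fix X assume "X \<in> carrier (cycle_space V E)"
  then show "f X = g X" using assms(1) by (auto simp: carrier_cycle_space)
qed

lemma cohomology_map_hom:
  assumes G: "simple_graph V E"
  shows "cohomology_map V E \<in> hom (SZC_group E) (graph_cohomology V E)"
proof (rule homI)
  fix u v :: "'a \<Rightarrow> 'a \<Rightarrow> 'a \<Rightarrow> 'b"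
  assume "u \<in> carrier (SZC_group E)" "v \<in> carrier (SZC_group E)"
  then have u: "u \<in> SZC E" and v: "v \<in> SZC E" by simp_all
  have ratio: "edge_ratio E (\<lambda>a b c. u a b c * v a b c) = (\<lambda>e. edge_ratio E u e * edge_ratio E v e)"
    by (auto simp: edge_ratio_def)
  show "cohomology_map V E (u \<otimes>\<^bsub>SZC_group E\<^esub> v) =
      cohomology_map V E u \<otimes>\<^bsub>graph_cohomology V E\<^esub> cohomology_map V E v"
  proof (rule cycle_space_extensionalityI[of E _ _ V])
    fix x assume x: "x \<in> cycles E"
    then have "chain_class E x \<in> carrier (cycle_space V E)" by (auto simp: carrier_cycle_space)
    then show "cohomology_map V E (u \<otimes>\<^bsub>SZC_group E\<^esub> v) (chain_class E x) =
        (cohomology_map V E u \<otimes>\<^bsub>graph_cohomology V E\<^esub> cohomology_map V E v) (chain_class E x)"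
      by (simp add: cohomology_map_chain_class[OF G _ x] u v SZC_mult ratio evaluation_mult)
  qed (simp_all add: cohomology_map_def)
qed (use cohomology_map_closed[OF G] in simp)

lemma evaluation_cong:
  assumes "\<And>a b. {a, b} \<in> E \<Longrightarrow> \<theta> (a, b) = \<eta> (a, b)"
  shows "evaluation (directed_edges E) \<theta> x = evaluation (directed_edges E) \<eta> x"
  unfolding evaluation_def using assms by (intro prod.cong) auto

text \<open>
  If \<open>w\<close> is given by a symmetric \<open>m\<close>, its edge ratio is \<open>f a / f b\<close> for the values \<open>f a\<close> of \<open>m\<close> at
  the edge from \<open>a\<close> to the chosen neighbour, so it is trivial on cycles.  Conversely, consider the
  cycle that runs from the base vertex to \<open>a\<close>, along \<open>(a | b)\<close>, and back from \<open>b\<close>.  Triviality on it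
  writes the edge ratio as \<open>f a / f b\<close>, and then \<open>f a / l a b\<close> is symmetric.
\<close>
lemma cohomology_map_eq_one_iff:
  assumes G: "simple_graph V E" and con: "connected_graph V E" and w: "w \<in> SZC E"
  shows "cohomology_map V E w = \<one>\<^bsub>graph_cohomology V E\<^esub> \<longleftrightarrow> same_up_to_rescaling E (\<lambda>a b c. 1) w"
proof
  let ?n = "\<lambda>a. SOME c. {a, c} \<in> E"
  have n: "{a, ?n a} \<in> E" if "{a, b} \<in> E" for a b
    using that by (rule someI)
  assume "same_up_to_rescaling E (\<lambda>a b c. 1) w"
  then obtain m where m: "\<And>a b. {a, b} \<in> E \<Longrightarrow> m a b \<noteq> 0" "\<And>a b. {a, b} \<in> E \<Longrightarrow> m a b = m b a"
    and wm: "\<And>a b c. {a, b} \<in> E \<Longrightarrow> {a, c} \<in> E \<Longrightarrow> w a b c * m a b = m a c"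
    unfolding same_up_to_rescaling_def by force
  (* The value 1 at isolated vertices only serves to make f nonzero everywhere. *)
  define f where "f a = (if {a, ?n a} \<in> E then m a (?n a) else 1)" for a
  have "edge_ratio E w (a, b) = (\<lambda>(a, b). f a / f b) (a, b)" if e: "{a, b} \<in> E" for a b
  proof -
    note e' = simple_graph_edgeD(4)[OF G e]
    have "w a b (?n a) = f a / m a b" "w b a (?n b) = f b / m a b"
      using wm[OF e n[OF e]] wm[OF e' n[OF e']] m(1)[OF e] m(2)[OF e] n[OF e] n[OF e']
      by (simp_all add: f_def field_simps)
    then show ?thesis
      using m(1)[OF e] by (simp add: edge_ratio_def)
  qed
  moreover have "f a \<noteq> 0" for a
    using m(1) by (simp add: f_def)
  ultimately have "evaluation (directed_edges E) (edge_ratio E w) x = 1" if "x \<in> cycles E" for x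
    using evaluation_cong[of E "edge_ratio E w" "\<lambda>(a, b). f a / f b" x]
      evaluation_coboundary[OF G _ that, of f] by simp
  then show "cohomology_map V E w = \<one>\<^bsub>graph_cohomology V E\<^esub>"
    by (intro cycle_space_extensionalityI[of E _ _ V])
      (auto simp: cohomology_map_chain_class[OF G w] carrier_cycle_space, auto simp: cohomology_map_def carrier_cycle_space)
next
  let ?n = "\<lambda>a. SOME c. {a, c} \<in> E"
  let ?g = "evaluation (directed_edges E) (edge_ratio E w)"
  have n: "{a, ?n a} \<in> E" if "{a, b} \<in> E" for a b
    using that by (rule someI)
  note g = evaluation_edge_ratio[OF G w]
  assume triv: "cohomology_map V E w = \<one>\<^bsub>graph_cohomology V E\<^esub>"
  have cyc: "?g x = 1" if "x \<in> cycles E" for x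
    using cohomology_map_chain_class[OF G w that] triv that by (auto simp: carrier_cycle_space)
  obtain r P where P: "\<And>a. a \<in> V \<Longrightarrow> P a \<in> carrier (edge_chains E)"
    "\<And>a. a \<in> V \<Longrightarrow> chain_boundary (P a) = frag_of r - frag_of a"
    using base_vertex_chains[OF con] by metis
  define f where "f a = inverse (?g (P a))" for a
  have f0: "f a \<noteq> 0" if "a \<in> V" for a
    using character_simps(1)[OF g, of "P a"] P(1)[OF that] by (simp add: f_def)
  have ratio: "w a b (?n a) / w b a (?n b) = f a / f b" if e: "{a, b} \<in> E" for a b
  proof -
    note ab = simple_graph_edgeD(1,2)[OF G e]
    have e': "frag_of (a, b) \<in> carrier (edge_chains E)" using e by simp
    have 1: "P a + frag_of (a, b) \<in> carrier (edge_chains E)"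
      by (intro edge_chains_add P ab e')
    have "P a + frag_of (a, b) - P b \<in> cycles E"
      using edge_chains_diff[OF 1 P(1)[OF ab(2)]] P(2)[OF ab(1)] P(2)[OF ab(2)] by simp
    then have "1 = ?g (P a + frag_of (a, b) - P b)"
      by (rule cyc[symmetric])
    also have "\<dots> = ?g (P a) * edge_ratio E w (a, b) / ?g (P b)"
      using 1 P(1)[OF ab(1)] P(1)[OF ab(2)] e
      by (simp add: character_simps(4,5)[OF g] evaluation_frag_of[OF finite_directed_edges[OF G]])
    finally have "?g (P b) = ?g (P a) * edge_ratio E w (a, b)"
      by (simp add: eq_divide_eq_1)
    then show ?thesis
      using f0[OF ab(1)] by (simp add: f_def edge_ratio_def field_simps)
  qed
  define m where "m a b = f a / w a b (?n a)" for a b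
  have w0: "w a b c \<noteq> 0" for a b c by (rule SZC_nonzero[OF w])
  have "m a b \<noteq> 0 \<and> m a b = m b a" if e: "{a, b} \<in> E" for a b
    using ratio[OF e] f0[OF simple_graph_edgeD(1)[OF G e]] f0[OF simple_graph_edgeD(2)[OF G e]] w0 by (simp add: m_def field_simps)
  moreover have "w a b c * m a b = 1 * m a c" if e: "{a, b} \<in> E" "{a, c} \<in> E" for a b c
    using SZC_cocycle(1)[OF w e n[OF e(1)]] w0[of a b "?n a"] w0[of a c "?n a"] by (simp add: m_def field_simps)
  ultimately show "same_up_to_rescaling E (\<lambda>a b c. 1) w"
    unfolding same_up_to_rescaling_def by blast
qed

text \<open>
  A character \<open>h\<close> of the cycles is extended to all chains by composing it with a projection \<open>D\<close> onto
  the cycles.  Its value \<open>\<theta>\<close> on edges is antisymmetric, and an orientation of the edges splits it as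
  \<open>l a b / l b a\<close>.
\<close>
lemma cohomology_map_surj:
  fixes h :: "('v \<times> 'v \<Rightarrow>\<^sub>0 int) set \<Rightarrow> 'k::field"
  assumes G: "simple_graph V E" and con: "connected_graph V E"
    and h: "h \<in> carrier (graph_cohomology V E)"
  shows "\<exists>v\<in>SZC E. cohomology_map V E v = h"
proof -
  let ?n = "\<lambda>a. SOME c. {a, c} \<in> E"
  have n: "{a, ?n a} \<in> E" if "{a, b} \<in> E" for a b
    using that by (rule someI)
  have hmult: "h (chain_class E (x + y)) = h (chain_class E x) * h (chain_class E y)"
    and hnz: "h (chain_class E x) \<noteq> 0" if "x \<in> cycles E" "y \<in> cycles E" for x y
  proof -
    have "chain_class E x \<in> carrier (cycle_space V E)" "chain_class E y \<in> carrier (cycle_space V E)"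
      using that by (auto simp: carrier_cycle_space)
    moreover have "h \<in> hom (cycle_space V E) unit_group" using h by simp
    ultimately show "h (chain_class E (x + y)) = h (chain_class E x) * h (chain_class E y)"
      "h (chain_class E x) \<noteq> 0"
      using that hom_mult[of h "cycle_space V E" unit_group "chain_class E x" "chain_class E y"]
        mult_cycle_space[of x E y V] hom_in_carrier[of h "cycle_space V E" unit_group "chain_class E x"] by auto
  qed
  obtain r P where P: "\<And>a. a \<in> V \<Longrightarrow> P a \<in> carrier (edge_chains E)"
    "\<And>a. a \<in> V \<Longrightarrow> chain_boundary (P a) = frag_of r - frag_of a"
    using base_vertex_chains[OF con] by metis
  (* D adds to x paths from the base vertex that cancel its boundary, and fixes every cycle. *)
  define D where "D x = x + frag_extend P (chain_boundary x)" for x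
  have D_add: "D (x + y) = D x + D y" for x y
    by (simp add: D_def frag_extend_add)
  have D_cycles: "D x \<in> cycles E" if "x \<in> carrier (edge_chains E)" for x
  proof -
    have "Poly_Mapping.keys x \<subseteq> directed_edges E" using that by simp
    then show ?thesis
    proof (induction x rule: free_Abelian_group_induct[consumes 1, case_names zero diff generator])
      case (diff x y)
      have "D (x - y) = D x - D y"
        by (simp add: D_def frag_extend_diff)
      then show ?case using diff edge_chains_diff[of "D x" E "D y"] by simp
    next
      case (generator e)
      obtain a b where e: "e = (a, b)" by (cases e)
      then have ab: "{a, b} \<in> E" using generator by simp
      note V = simple_graph_edgeD(1,2)[OF G ab]
      have D: "D (frag_of e) = frag_of (a, b) + (P a - P b)"
        by (simp add: D_def e frag_extend_diff)
      have "frag_of (a, b) + (P a - P b) \<in> carrier (edge_chains E)"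
        by (intro edge_chains_add edge_chains_diff P V) (simp add: ab)
      then show ?case
        unfolding D by (simp add: P(2)[OF V(1)] P(2)[OF V(2)])
    qed (simp add: D_def)
  qed
  define g where "g x = h (chain_class E (D x))" for x
  have g: "g \<in> hom (edge_chains E) unit_group"
    using hmult[OF D_cycles D_cycles] hnz[OF D_cycles D_cycles] by (intro homI) (simp_all add: g_def D_add)
  define \<theta> where "\<theta> e = g (frag_of e)" for e
  have \<theta>0: "\<theta> (a, b) \<noteq> 0" if "{a, b} \<in> E" for a b
    unfolding \<theta>_def using that by (intro character_simps(1)[OF g]) simp
  have \<theta>_eval: "evaluation (directed_edges E) \<theta> x = g x" if "x \<in> carrier (edge_chains E)" for x
  proof (rule character_eqI[OF evaluation_hom[OF finite_directed_edges[OF G]] g])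
    show "\<theta> e \<noteq> 0" if "e \<in> directed_edges E" for e
      using \<theta>0 that by (cases e) auto
    show "evaluation (directed_edges E) \<theta> (frag_of e) = g (frag_of e)" if "e \<in> directed_edges E" for e
      using evaluation_frag_of[OF finite_directed_edges[OF G] that, of \<theta>] by (simp add: \<theta>_def)
  qed (use that in simp)
  have \<theta>_flip: "\<theta> (a, b) * \<theta> (b, a) = 1" if e: "{a, b} \<in> E" for a b
  proof -
    let ?x = "frag_of (a, b) + frag_of (b, a)"
    have "?x \<in> flips E"
      unfolding flips_def by (rule generate.incl) (use e in blast)
    then have "chain_class E ?x = chain_class E 0"
      by (intro chain_class_eqI) simp_all
    then have "g ?x = g 0"
      by (simp add: g_def D_def)
    also have "\<dots> = 1"
      using character_simps(2)[OF g, of 0] by simp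
    finally show ?thesis
      using character_simps(4)[OF g, of "frag_of (a, b)" "frag_of (b, a)"] e simple_graph_edgeD(4)[OF G e]
      by (simp add: \<theta>_def)
  qed
  (* The chosen end of an edge carries the full value; the factor at the other end is 1. *)
  define l where "l a b = (if {a, b} \<in> E \<and> a = (SOME x. x \<in> {a, b}) then \<theta> (a, b) else 1)" for a b
  have l0: "l a b \<noteq> 0" for a b
    by (simp add: l_def \<theta>0)
  have l_ratio: "l a b / l b a = \<theta> (a, b)" if e: "{a, b} \<in> E" for a b
  proof -
    have "(SOME x. x \<in> {a, b}) \<in> {a, b}" by (rule someI[of _ a]) simp
    moreover have "{b, a} = {a, b}" by auto
    ultimately show ?thesis
      using e simple_graph_edgeD(3)[OF G e] \<theta>_flip[OF e] \<theta>0[OF simple_graph_edgeD(4)[OF G e]]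
      by (auto simp: l_def nonzero_divide_eq_eq)
  qed
  define v where "v a b c = (if {a, b} \<in> E \<and> {a, c} \<in> E then l a b / l a c else 1)" for a b c
  have v: "v \<in> SZC E"
    unfolding SZC_def v_def using l0 by auto
  (* edge_ratio normalizes l at the chosen neighbours, which multiplies theta by a coboundary. *)
  define f where "f a = inverse (l a (?n a))" for a
  have "edge_ratio E v (a, b) = \<theta> (a, b) * (case (a, b) of (a, b) \<Rightarrow> f a / f b)" if e: "{a, b} \<in> E" for a b
    using l_ratio[OF e, symmetric] n[OF e] n[OF simple_graph_edgeD(4)[OF G e]] e simple_graph_edgeD(4)[OF G e] l0
    by (simp add: edge_ratio_def v_def f_def field_simps)
  then have "evaluation (directed_edges E) (edge_ratio E v) x =
      evaluation (directed_edges E) \<theta> x * evaluation (directed_edges E) (\<lambda>(a, b). f a / f b) x" for x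
    unfolding evaluation_mult[symmetric] by (intro evaluation_cong) simp
  then have "evaluation (directed_edges E) (edge_ratio E v) x = h (chain_class E x)" if "x \<in> cycles E" for x
    using evaluation_coboundary[OF G _ that, of f] \<theta>_eval[of x] that l0 by (simp add: f_def g_def D_def)
  then have "cohomology_map V E v (chain_class E x) = h (chain_class E x)" if "x \<in> cycles E" for x
    using cohomology_map_chain_class[OF G v that] that by simp
  moreover have "cohomology_map V E v \<in> extensional (carrier (cycle_space V E))"
    "h \<in> extensional (carrier (cycle_space V E))"
    using h by (simp_all add: cohomology_map_def)
  ultimately have "cohomology_map V E v = h"
    by (rule cycle_space_extensionalityI[of E _ _ V])
  then show ?thesis using v by blast
qed

section \<open>The two isomorphisms\<close>

lemma bij_betw_quotient_pullback:
  assumes R: "R \<subseteq> S \<times> S" and T: "T \<subseteq> F ` S \<times> F ` S"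
    and RT: "\<And>x y. x \<in> S \<Longrightarrow> y \<in> S \<Longrightarrow> (x, y) \<in> R \<longleftrightarrow> (F x, F y) \<in> T"
  shows "bij_betw (\<lambda>X. {x \<in> S. F x \<in> X}) ((F ` S) // T) (S // R)"
proof -
  have pull: "{y \<in> S. F y \<in> T `` {F x}} = R `` {x}" if "x \<in> S" for x
    using R RT that by auto
  have push: "T `` {F x} = F ` (R `` {x})" if "x \<in> S" for x
    using T R RT that by force
  show ?thesis
  proof (rule bij_betw_imageI)
    show "inj_on (\<lambda>X. {x \<in> S. F x \<in> X}) ((F ` S) // T)"
    proof (rule inj_onI)
      fix X Y assume X: "X \<in> (F ` S) // T" and Y: "Y \<in> (F ` S) // T"
        and XY: "{x \<in> S. F x \<in> X} = {x \<in> S. F x \<in> Y}"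
      obtain x y where x: "x \<in> S" "X = T `` {F x}" and y: "y \<in> S" "Y = T `` {F y}"
        using X Y unfolding quotient_def by blast
      have "R `` {x} = R `` {y}"
        using XY unfolding x(2) y(2) pull[OF x(1)] pull[OF y(1)] .
      then show "X = Y"
        unfolding x(2) y(2) push[OF x(1)] push[OF y(1)] by simp
    qed
    have "(\<lambda>X. {x \<in> S. F x \<in> X}) ` ((F ` S) // T) = (\<lambda>x. {y \<in> S. F y \<in> T `` {F x}}) ` S"
      by (auto simp: quotient_def)
    also have "\<dots> = (\<lambda>x. R `` {x}) ` S"
      by (intro image_cong refl pull)
    finally show "(\<lambda>X. {x \<in> S. F x \<in> X}) ` ((F ` S) // T) = S // R"
      by (auto simp: quotient_def)
  qed
qed

lemma bij_betw_algebras_coefficients: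
  "bij_betw (\<lambda>X. {v \<in> SZC E. skew_zigzag_algebra V E v \<in> X})
    (skew_zigzag_algebras V E // algebra_rel V E) (SZC E // SZC_rel V E)"
  unfolding skew_zigzag_algebras_def
  by (rule bij_betw_quotient_pullback) (auto simp: SZC_rel_def algebra_rel_def skew_zigzag_algebras_def)

text \<open>
  The equivalence classes are the cosets of the kernel, because \<open>v\<close> and \<open>u\<close> are equivalent iff the
  quotient \<open>u / v\<close> is equivalent to the trivial collection.
\<close>
lemma SZC_quotient_eq:
  fixes V :: "'v set"
  assumes sqrt: "\<forall>x::'k::field. \<exists>y. y ^ 2 = x" and G: "simple_graph V E" and con: "connected_graph V E"
  shows "(SZC_quotient V E :: ('v \<Rightarrow> 'v \<Rightarrow> 'v \<Rightarrow> 'k) set monoid) =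
    SZC_group E Mod kernel (SZC_group E) (graph_cohomology V E) (cohomology_map V E)"
proof -
  let ?K = "kernel (SZC_group E) (graph_cohomology V E) (cohomology_map V E) :: ('v \<Rightarrow> 'v \<Rightarrow> 'v \<Rightarrow> 'k) set"
  have K: "w \<in> ?K \<longleftrightarrow> w \<in> SZC E \<and> same_up_to_rescaling E (\<lambda>a b c. 1) w" for w
    unfolding kernel_def using cohomology_map_eq_one_iff[OF G con, of w] by auto
  have coset: "SZC_rel V E `` {v} = ?K #>\<^bsub>SZC_group E\<^esub> v" if v: "v \<in> SZC E" for v
  proof (intro equalityI subsetI)
    fix u assume "u \<in> SZC_rel V E `` {v}"
    then have u: "u \<in> SZC E" and vu: "same_up_to_rescaling E v u"
      by (auto simp: SZC_rel_iff[OF sqrt G])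
    let ?w = "\<lambda>a b c. u a b c * inverse (v a b c)"
    have "?w \<in> SZC E"
      by (intro SZC_mult SZC_inverse u v)
    moreover have "same_up_to_rescaling E (\<lambda>a b c. 1) ?w"
      using vu SZC_nonzero[OF v] unfolding same_up_to_rescaling_def by (simp add: field_simps)
    moreover have "u = ?w \<otimes>\<^bsub>SZC_group E\<^esub> v"
      using SZC_nonzero[OF v] by (simp add: fun_eq_iff)
    ultimately show "u \<in> ?K #>\<^bsub>SZC_group E\<^esub> v"
      unfolding r_coset_def using K by blast
  next
    fix u assume "u \<in> ?K #>\<^bsub>SZC_group E\<^esub> v"
    then obtain w where w: "w \<in> SZC E" "same_up_to_rescaling E (\<lambda>a b c. 1) w" and u: "u = (\<lambda>a b c. w a b c * v a b c)"
      unfolding r_coset_def using K by auto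
    have "same_up_to_rescaling E v u"
      using w(2) unfolding same_up_to_rescaling_def u
    proof (elim exE conjE, intro exI conjI)
      fix m assume m: "\<forall>a b c. {a, b} \<in> E \<and> {a, c} \<in> E \<longrightarrow> w a b c * m a b = 1 * m a c"
      show "\<forall>a b c. {a, b} \<in> E \<and> {a, c} \<in> E \<longrightarrow> w a b c * v a b c * m a b = v a b c * m a c"
        using m by (simp add: mult_ac)
    qed
    then show "u \<in> SZC_rel V E `` {v}"
      using v SZC_mult[OF w(1) v] by (simp add: SZC_rel_iff[OF sqrt G] u)
  qed
  have "SZC E // SZC_rel V E = rcosets\<^bsub>SZC_group E\<^esub> ?K"
    unfolding quotient_def RCOSETS_def using coset by auto
  moreover have "SZC_rel V E `` {\<one>\<^bsub>SZC_group E\<^esub>} = ?K"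
  proof -
    have "(\<lambda>a b c. 1) \<in> SZC E" by (simp add: SZC_def)
    then have "SZC_rel V E `` {\<one>\<^bsub>SZC_group E\<^esub>} = ?K #>\<^bsub>SZC_group E\<^esub> \<one>\<^bsub>SZC_group E\<^esub>"
      using coset by simp
    then show ?thesis by (simp add: r_coset_def)
  qed
  ultimately show ?thesis
    by (simp add: SZC_quotient_def FactGroup_def)
qed

theorem theorem4p8:
  fixes V :: "'v set" and E :: "'v set set"
  assumes "\<forall>x::'k::field. \<exists>y. y ^ 2 = x"
    and "simple_graph V E"
    and "connected_graph V E"
  shows
    "(\<exists>f. bij_betw f
        ((skew_zigzag_algebras V E ::
            ('k, ('v, 'k) combination set, 'v) graded_algebra set) // algebra_rel V E)
        ((SZC E :: ('v \<Rightarrow> 'v \<Rightarrow> 'v \<Rightarrow> 'k) set) // SZC_rel V E)) \<and>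
     group (SZC_quotient V E :: ('v \<Rightarrow> 'v \<Rightarrow> 'v \<Rightarrow> 'k) set monoid) \<and>
     group (graph_cohomology V E :: (('v \<times> 'v \<Rightarrow>\<^sub>0 int) set \<Rightarrow> 'k) monoid) \<and>
     (SZC_quotient V E :: ('v \<Rightarrow> 'v \<Rightarrow> 'v \<Rightarrow> 'k) set monoid) \<cong>
       (graph_cohomology V E :: (('v \<times> 'v \<Rightarrow>\<^sub>0 int) set \<Rightarrow> 'k) monoid)"
proof -
  interpret group_hom "SZC_group E :: ('v \<Rightarrow> 'v \<Rightarrow> 'v \<Rightarrow> 'k) monoid" "graph_cohomology V E" "cohomology_map V E"
    by (intro group_hom.intro group_hom_axioms.intro group_SZC_group group_graph_cohomology
        cohomology_map_hom assms)
  have "cohomology_map V E ` carrier (SZC_group E) =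
      carrier (graph_cohomology V E :: (('v \<times> 'v \<Rightarrow>\<^sub>0 int) set \<Rightarrow> 'k) monoid)"
    using cohomology_map_surj[OF assms(2,3)] cohomology_map_closed[OF assms(2)] by fastforce
  then have "(SZC_quotient V E :: ('v \<Rightarrow> 'v \<Rightarrow> 'v \<Rightarrow> 'k) set monoid) \<cong>
      (graph_cohomology V E :: (('v \<times> 'v \<Rightarrow>\<^sub>0 int) set \<Rightarrow> 'k) monoid)"
    unfolding SZC_quotient_eq[OF assms] by (rule FactGroup_iso)
  moreover have "group (SZC_quotient V E :: ('v \<Rightarrow> 'v \<Rightarrow> 'v \<Rightarrow> 'k) set monoid)"
    unfolding SZC_quotient_eq[OF assms] by (intro normal.factorgroup_is_group normal_kernel)
  ultimately show ?thesis
    using bij_betw_algebras_coefficients group_graph_cohomology by blast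
qed

end
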